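(* Let the operators $\mathcal S^m$, $m\ge 1$, satisfy $$\operatorname{Im}\sum_{m=1}^M\bigl(\mathcal S^m\boldsymbol\Phi^m,\overline s_t\Phi^m\bigr)_{\omega_\delta}\tau_m\ge 0\quad\text{for any } M\ge 1,$$ for any function $\Phi:\overline\omega_\delta\times\overline\omega^{\,\tau}\to\mathbb C$ such that $\Phi^0=0$ and $\Phi|_{k=0,K}=0$, where $\boldsymbol\Phi^m=\{\Phi^1,\dots,\Phi^m\}$. Then the splitting in potential scheme (described in the context) is uniquely solvable. In particular, for $F=0$ its solution satisfies $$\max_{m\ge 0}\|\sqrt{\rho_{\mathbf h}}\,\Psi^m\|_{\overline\omega_{\mathbf h}}=\|\sqrt{\rho_{\mathbf h}}\,\Psi^0_{\mathbf h}\|_{\overline\omega_{\mathbf h}}.$$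
   Context: **Coefficients.** $\Omega=(0,\infty)\times(0,Y)$, $\Omega_X=(0,X)\times(0,Y)$, $\hbar>0$ constant. Real functions $\rho(x,y)\ge\underline\rho>0$, $V(x,y)$ and a real symmetric matrix $\mathbf B=\{B_{pq}(x,y)\}_{p,q=1}^2$, positive definite uniformly in $\Omega$, are given, and $\psi^0(x,y)$ is a complex-valued initial function. For some $X_0>0$, on $\Omega\setminus\Omega_{X_0}$: $B_{11}=B_{1\infty}>0$, $B_{12}=B_{21}=0$, $B_{22}=B_{2\infty}>0$, $\rho=\rho_\infty>0$, $V=V_\infty$ (constants), $\psi^0=0$. A real auxiliary potential $\widetilde V(x)$ satisfies $\widetilde V(x)=V_\infty$ for $x\ge X_0$. **Meshes.** $\overline\omega^{\,\tau}$: nodes $0=t_0<t_1<\dots$, $t_m\to\infty$, $\tau_m=t_m-t_{m-1}$. In $x$: nodes $0=x_0<\dots<x_J=X<\dots$ on $[0,\infty)$, where $X>X_0$, with $h_j=x_j-x_{j-1}$, $x_{J-2}\ge X_0$, $h_j=h:=h_J$ for $j\ge J$; $h_{j+1/2}=\frac{h_j+h_{j+1}}2$; $\overline\omega_h=\{x_j\}_{j=0}^J$, $\omega_h=\{x_j\}_{j=1}^{J-1}$. In $y$: $\overline\omega_\delta$ with nodes $0=y_0<\dots<y_K=Y$, $\delta_k=y_k-y_{k-1}$, $\delta_{k+1/2}=\frac{\delta_k+\delta_{k+1}}2$, $\omega_\delta=\{y_k\}_{k=1}^{K-1}$. $\overline\omega_{\mathbf h}=\overline\omega_h\times\overline\omega_\delta$,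 $\omega_{\mathbf h}=\omega_h\times\omega_\delta$, $\Gamma_{\mathbf h}=\{(0,y_k):1\le k\le K-1\}\cup\{(x_j,0),(x_j,Y):0\le j\le J\}$. **Mesh operators.** $\overline\partial_xW_j=\frac{W_j-W_{j-1}}{h_j}$, $\widehat\partial_xW_j=\frac{W_{j+1}-W_j}{h_{j+1/2}}$, $\overline s_xW_j=\frac{W_{j-1}+W_j}2$, $\widehat s_xW_j=\frac{h_jW_j+h_{j+1}W_{j+1}}{2h_{j+1/2}}$; $\overline\partial_y,\widehat\partial_y,\overline s_y,\widehat s_y$ are defined likewise in the index $k$ with steps $\delta_k,\delta_{k+1/2}$. $\overline s_t\Phi^m=\frac{\Phi^{m-1}+\Phi^m}2$. **Discrete coefficients.** $A_{-,jk}=A(\frac{x_{j-1}+x_j}2,\frac{y_{k-1}+y_k}2)$ for $A=\rho,B_{pq},V$ and $\widetilde V_{-,j}=\widetilde V(\frac{x_{j-1}+x_j}2)$; $B_{11\mathbf h}=\widehat s_yB_{11,-}$, $B_{22\mathbf h}=\widehat s_xB_{22,-}$, $B_{12\mathbf h}=B_{21\mathbf h}=B_{12,-}$, $\rho_{\mathbf h}=\widehat s_x\widehat s_y\rho_-$, $V_{\mathbf h}=\widehat s_x\widehat s_yV_-$, $\widetilde V_h=\widehat s_x\widetilde V_-$, $\Delta V_{\mathbf h}=V_{\mathbf h}-\widetilde V_h$. The mesh Hamiltonian is $$\mathcal H_{0\mathbf h}W=-\tfrac{\hbar^2}2\bigl[\widehat\partial_x(B_{11\mathbf h}\overline\partial_xW)+\widehat\partial_x\widehat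 s_y(B_{12\mathbf h}\overline s_x\overline\partial_yW)+\widehat s_x\widehat\partial_y(B_{21\mathbf h}\overline\partial_x\overline s_yW)+\widehat\partial_y(B_{22\mathbf h}\overline\partial_yW)\bigr].$$ **Inner products and norms.** $(U,W)_{\omega_\delta}=\sum_{k=1}^{K-1}U_kW_k^*\delta_{k+1/2}$; $(U,W)_{\overline\omega_{\mathbf h}}=\sum_{j=1}^{J-1}\sum_{k=1}^{K-1}U_{jk}W_{jk}^*h_{j+1/2}\delta_{k+1/2}+\sum_{k=1}^{K-1}U_{Jk}W_{Jk}^*\frac h2\delta_{k+1/2}$, with associated norm $\|\cdot\|_{\overline\omega_{\mathbf h}}$ ($*$ is complex conjugation). **Scheme.** For each $m\ge 1$, $\mathcal S^m$ is a linear operator taking functions on $\omega_\delta\times\{t_l\}_{l=1}^m$ to functions on $\omega_\delta$. Given $F^m:\overline\omega_{\mathbf h}\to\mathbb C$ with $F^m|_{\Gamma_{\mathbf h}}=0$ and $\Psi^0_{\mathbf h}$ with $(\Psi^0_{\mathbf h})_{jk}=\psi^0(x_j,y_k)$, where it is assumed that $\Psi^0_{\mathbf h}|_{j=J}=\Psi^0_{\mathbf h}|_{j=J-1}=0$ and $\Psi^0_{\mathbf h}|_{\Gamma_{\mathbf h}}=0$, the splitting in potential scheme is to find $\Psi^0=\Psi^0_{\mathbf h}$ and, for all $m\ge1$, functions $\breve\Psi^m,\widetilde\Psi^m,\Psi^m$ on $\overline\omega_{\mathbf h}$, vanishing on $\Gamma_{\mathbf h}$, with: (i) $\breve\Psi^m=\mathcal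 E^m\Psi^{m-1}$ and (iii) $\Psi^m=\mathcal E^m\widetilde\Psi^m$ on $(\omega_h\cup\{x_J\})\times\omega_\delta$, where either $\mathcal E^m=\dfrac{1-i\frac{\tau_m}{4\hbar\rho_{\mathbf h}}\Delta V_{\mathbf h}}{1+i\frac{\tau_m}{4\hbar\rho_{\mathbf h}}\Delta V_{\mathbf h}}$ (equivalently $i\hbar\rho_{\mathbf h}\frac{\breve\Psi^m-\Psi^{m-1}}{\tau_m/2}=\Delta V_{\mathbf h}\frac{\breve\Psi^m+\Psi^{m-1}}2$ and $i\hbar\rho_{\mathbf h}\frac{\Psi^m-\widetilde\Psi^m}{\tau_m/2}=\Delta V_{\mathbf h}\frac{\Psi^m+\widetilde\Psi^m}2$), or $\mathcal E^m=\exp\{-i\frac{\tau_m}{2\hbar\rho_{\mathbf h}}\Delta V_{\mathbf h}\}$ (both choices are admitted); (ii) $i\hbar\rho_{\mathbf h}\dfrac{\widetilde\Psi^m-\breve\Psi^m}{\tau_m}=(\mathcal H_{0\mathbf h}+\widetilde V_h)\dfrac{\widetilde\Psi^m+\breve\Psi^m}2+F^m$ on $\omega_{\mathbf h}$; (iv) (approximate transparent boundary condition) on $\omega_\delta$, $$\Bigl\{\tfrac{\hbar^2}2B_{1\infty}\overline\partial_x\tfrac{\widetilde\Psi^m+\breve\Psi^m}2-\tfrac h2\Bigl[i\hbar\rho_\infty\tfrac{\widetilde\Psi^m-\breve\Psi^m}{\tau_m}+\bigl(\tfrac{\hbar^2}2B_{2\infty}\widehat\partial_y\overline\partial_y-V_\infty\bigr)\tfrac{\widetilde\Psi^m+\breve\Psi^m}2\Bigr]\Bigr\}\Big|_{j=J}+\tfrac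 h2F^m|_{j=J}=\tfrac{\hbar^2}2B_{1\infty}\mathcal S^m\widetilde{\boldsymbol\Psi}^m_J,$$ where $\widetilde{\boldsymbol\Psi}^m_J=\{\widetilde\Psi^1_{J\cdot},\dots,\widetilde\Psi^m_{J\cdot}\}$. *)

theory Defs
  imports "HOL-Analysis.Analysis"
begin

text \<open>
  Mesh functions are functions of integer indices: \<open>W j k\<close> is the value at \<open>(x\<^sub>j, y\<^sub>k)\<close>, and an
  upper index \<open>m\<close> (the time level) comes first. They are total in HOL, so every statement
  is restricted to the index ranges on which the mesh function lives; values outside are junk.
\<close>

record coefficients =
  hbar :: real
  wid :: real                              \<comment> \<open>the width \<open>Y\<close> of the strip\<close>
  rho :: "real \<Rightarrow> real \<Rightarrow> real"
  Bmat :: "real \<Rightarrow> real \<Rightarrow> real ^ 2 ^ 2"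
  pot :: "real \<Rightarrow> real \<Rightarrow> real"
  pot_aux :: "real \<Rightarrow> real"                \<comment> \<open>the auxiliary potential \<open>V\<close> with tilde\<close>
  psi_init :: "real \<Rightarrow> real \<Rightarrow> complex"
  X0 :: real
  rho_inf :: real
  B1_inf :: real
  B2_inf :: real
  V_inf :: real

definition admissible_coefficients :: "coefficients \<Rightarrow> bool" where
  "admissible_coefficients c \<longleftrightarrow>
     hbar c > 0 \<and> wid c > 0 \<and> X0 c > 0 \<and>
     (\<exists>r>0. \<forall>x>0. \<forall>y. 0 < y \<and> y < wid c \<longrightarrow> rho c x y \<ge> r) \<and>
     (\<forall>x>0. \<forall>y. 0 < y \<and> y < wid c \<longrightarrow> transpose (Bmat c x y) = Bmat c x y) \<and>
     (\<exists>b>0. \<forall>x>0. \<forall>y. 0 < y \<and> y < wid c \<longrightarrow>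
        (\<forall>v. v \<bullet> (Bmat c x y *v v) \<ge> b * (norm v)\<^sup>2)) \<and>
     B1_inf c > 0 \<and> B2_inf c > 0 \<and> rho_inf c > 0 \<and>
     (\<forall>x\<ge>X0 c. \<forall>y. 0 < y \<and> y < wid c \<longrightarrow>
        Bmat c x y $ 1 $ 1 = B1_inf c \<and> Bmat c x y $ 1 $ 2 = 0 \<and>
        Bmat c x y $ 2 $ 1 = 0 \<and> Bmat c x y $ 2 $ 2 = B2_inf c \<and>
        rho c x y = rho_inf c \<and> pot c x y = V_inf c \<and> psi_init c x y = 0) \<and>
     (\<forall>x\<ge>X0 c. pot_aux c x = V_inf c)"

record mesh =
  tn :: "nat \<Rightarrow> real"
  xn :: "nat \<Rightarrow> real"
  yn :: "nat \<Rightarrow> real"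
  nx :: nat                                \<comment> \<open>\<open>J\<close>; thus \<open>X = x\<^sub>J\<close>\<close>
  ny :: nat                                \<comment> \<open>\<open>K\<close>\<close>

definition step :: "(nat \<Rightarrow> real) \<Rightarrow> nat \<Rightarrow> real" where
  "step z j = z j - z (j - 1)"

definition half_step :: "(nat \<Rightarrow> real) \<Rightarrow> nat \<Rightarrow> real" where
  "half_step z j = (step z j + step z (j + 1)) / 2"

definition admissible_mesh :: "coefficients \<Rightarrow> mesh \<Rightarrow> bool" where
  "admissible_mesh c g \<longleftrightarrow>
     tn g 0 = 0 \<and> strict_mono (tn g) \<and> filterlim (tn g) at_top sequentially \<and>
     xn g 0 = 0 \<and> strict_mono (xn g) \<and> 2 \<le> nx g \<and> X0 c < xn g (nx g) \<and> X0 c \<le> xn g (nx g - 2) \<and>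
     (\<forall>j\<ge>nx g. step (xn g) j = step (xn g) (nx g)) \<and>
     yn g 0 = 0 \<and> strict_mono_on {0..ny g} (yn g) \<and> yn g (ny g) = wid c"

text \<open>
  One-dimensional mesh operators on a mesh with nodes \<open>z\<close>; \<open>bar\<close> and \<open>hat\<close> refer to the accent
  over the operator. They apply to real coefficients and to complex mesh functions.
\<close>

definition bar_d :: "(nat \<Rightarrow> real) \<Rightarrow> (nat \<Rightarrow> 'a::real_vector) \<Rightarrow> nat \<Rightarrow> 'a" where
  "bar_d z W j = (W j - W (j - 1)) /\<^sub>R step z j"

definition hat_d :: "(nat \<Rightarrow> real) \<Rightarrow> (nat \<Rightarrow> 'a::real_vector) \<Rightarrow> nat \<Rightarrow> 'a" where
  "hat_d z W j = (W (j + 1) - W j) /\<^sub>R half_step z j"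

definition bar_s :: "(nat \<Rightarrow> 'a::real_vector) \<Rightarrow> nat \<Rightarrow> 'a" where
  "bar_s W j = (W (j - 1) + W j) /\<^sub>R 2"

definition hat_s :: "(nat \<Rightarrow> real) \<Rightarrow> (nat \<Rightarrow> 'a::real_vector) \<Rightarrow> nat \<Rightarrow> 'a" where
  "hat_s z W j = (step z j *\<^sub>R W j + step z (j + 1) *\<^sub>R W (j + 1)) /\<^sub>R (2 * half_step z j)"

definition in_x :: "((nat \<Rightarrow> 'a) \<Rightarrow> nat \<Rightarrow> 'a) \<Rightarrow> (nat \<Rightarrow> nat \<Rightarrow> 'a) \<Rightarrow> nat \<Rightarrow> nat \<Rightarrow> 'a" where
  "in_x A W = (\<lambda>j k. A (\<lambda>i. W i k) j)"

definition in_y :: "((nat \<Rightarrow> 'a) \<Rightarrow> nat \<Rightarrow> 'a) \<Rightarrow> (nat \<Rightarrow> nat \<Rightarrow> 'a) \<Rightarrow> nat \<Rightarrow> nat \<Rightarrow> 'a" where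
  "in_y A W = (\<lambda>j k. A (\<lambda>i. W j i) k)"

definition midpoint_value :: "mesh \<Rightarrow> (real \<Rightarrow> real \<Rightarrow> real) \<Rightarrow> nat \<Rightarrow> nat \<Rightarrow> real" where
  "midpoint_value g A j k = A ((xn g (j - 1) + xn g j) / 2) ((yn g (k - 1) + yn g k) / 2)"

definition B11_h :: "coefficients \<Rightarrow> mesh \<Rightarrow> nat \<Rightarrow> nat \<Rightarrow> real" where
  "B11_h c g = in_y (hat_s (yn g)) (midpoint_value g (\<lambda>x y. Bmat c x y $ 1 $ 1))"

definition B22_h :: "coefficients \<Rightarrow> mesh \<Rightarrow> nat \<Rightarrow> nat \<Rightarrow> real" where
  "B22_h c g = in_x (hat_s (xn g)) (midpoint_value g (\<lambda>x y. Bmat c x y $ 2 $ 2))"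

definition B12_h :: "coefficients \<Rightarrow> mesh \<Rightarrow> nat \<Rightarrow> nat \<Rightarrow> real" where
  "B12_h c g = midpoint_value g (\<lambda>x y. Bmat c x y $ 1 $ 2)"

definition B21_h :: "coefficients \<Rightarrow> mesh \<Rightarrow> nat \<Rightarrow> nat \<Rightarrow> real" where
  "B21_h c g = midpoint_value g (\<lambda>x y. Bmat c x y $ 2 $ 1)"

definition rho_h :: "coefficients \<Rightarrow> mesh \<Rightarrow> nat \<Rightarrow> nat \<Rightarrow> real" where
  "rho_h c g = in_x (hat_s (xn g)) (in_y (hat_s (yn g)) (midpoint_value g (rho c)))"

definition V_h :: "coefficients \<Rightarrow> mesh \<Rightarrow> nat \<Rightarrow> nat \<Rightarrow> real" where
  "V_h c g = in_x (hat_s (xn g)) (in_y (hat_s (yn g)) (midpoint_value g (pot c)))"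

definition V_aux_h :: "coefficients \<Rightarrow> mesh \<Rightarrow> nat \<Rightarrow> real" where
  "V_aux_h c g = hat_s (xn g) (\<lambda>j. pot_aux c ((xn g (j - 1) + xn g j) / 2))"

definition Delta_V_h :: "coefficients \<Rightarrow> mesh \<Rightarrow> nat \<Rightarrow> nat \<Rightarrow> real" where
  "Delta_V_h c g j k = V_h c g j k - V_aux_h c g j"

definition H0_h :: "coefficients \<Rightarrow> mesh \<Rightarrow> (nat \<Rightarrow> nat \<Rightarrow> complex) \<Rightarrow> nat \<Rightarrow> nat \<Rightarrow> complex" where
  "H0_h c g W j k = - complex_of_real ((hbar c)\<^sup>2 / 2) *
    (in_x (hat_d (xn g)) (\<lambda>j k. B11_h c g j k *\<^sub>R in_x (bar_d (xn g)) W j k) j k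
   + in_x (hat_d (xn g)) (in_y (hat_s (yn g))
       (\<lambda>j k. B12_h c g j k *\<^sub>R in_x bar_s (in_y (bar_d (yn g)) W) j k)) j k
   + in_x (hat_s (xn g)) (in_y (hat_d (yn g))
       (\<lambda>j k. B21_h c g j k *\<^sub>R in_x (bar_d (xn g)) (in_y bar_s W) j k)) j k
   + in_y (hat_d (yn g)) (\<lambda>j k. B22_h c g j k *\<^sub>R in_y (bar_d (yn g)) W j k) j k)"

definition inner_delta :: "mesh \<Rightarrow> (nat \<Rightarrow> complex) \<Rightarrow> (nat \<Rightarrow> complex) \<Rightarrow> complex" where
  "inner_delta g U W = (\<Sum>k = 1..ny g - 1. U k * cnj (W k) * complex_of_real (half_step (yn g) k))"

definition inner_mesh ::
    "mesh \<Rightarrow> (nat \<Rightarrow> nat \<Rightarrow> complex) \<Rightarrow> (nat \<Rightarrow> nat \<Rightarrow> complex) \<Rightarrow> complex" where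
  "inner_mesh g U W =
     (\<Sum>j = 1..nx g - 1. \<Sum>k = 1..ny g - 1. U j k * cnj (W j k) *
        complex_of_real (half_step (xn g) j * half_step (yn g) k))
   + (\<Sum>k = 1..ny g - 1. U (nx g) k * cnj (W (nx g) k) *
        complex_of_real (step (xn g) (nx g) / 2 * half_step (yn g) k))"

definition norm_mesh :: "mesh \<Rightarrow> (nat \<Rightarrow> nat \<Rightarrow> complex) \<Rightarrow> real" where
  "norm_mesh g W = sqrt (Re (inner_mesh g W W))"

definition vanishes_on_Gamma :: "mesh \<Rightarrow> (nat \<Rightarrow> nat \<Rightarrow> complex) \<Rightarrow> bool" where
  "vanishes_on_Gamma g W \<longleftrightarrow>
     (\<forall>k\<in>{1..ny g - 1}. W 0 k = 0) \<and> (\<forall>j\<in>{0..nx g}. W j 0 = 0 \<and> W j (ny g) = 0)"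

definition eq_on_mesh :: "mesh \<Rightarrow> (nat \<Rightarrow> nat \<Rightarrow> complex) \<Rightarrow> (nat \<Rightarrow> nat \<Rightarrow> complex) \<Rightarrow> bool" where
  "eq_on_mesh g U W \<longleftrightarrow> (\<forall>j\<in>{0..nx g}. \<forall>k\<in>{0..ny g}. U j k = W j k)"

definition Psi_init_h :: "coefficients \<Rightarrow> mesh \<Rightarrow> nat \<Rightarrow> nat \<Rightarrow> complex" where
  "Psi_init_h c g j k = psi_init c (xn g j) (yn g k)"

text \<open>
  A linear operator from functions on the interior \<open>y\<close>-nodes and the time levels \<open>1, \<dots>, m\<close> to
  functions on the interior \<open>y\<close>-nodes. The first conjunct says that only the values at these
  arguments matter, so that \<open>S m\<close> may be applied to a function \<open>\<Phi> l k\<close> given at all levels \<open>l\<close>.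
\<close>

definition linear_boundary_operator ::
    "mesh \<Rightarrow> nat \<Rightarrow> ((nat \<Rightarrow> nat \<Rightarrow> complex) \<Rightarrow> nat \<Rightarrow> complex) \<Rightarrow> bool" where
  "linear_boundary_operator g m T \<longleftrightarrow>
     (\<forall>U W. (\<forall>l\<in>{1..m}. \<forall>k\<in>{1..ny g - 1}. U l k = W l k) \<longrightarrow>
        (\<forall>k\<in>{1..ny g - 1}. T U k = T W k)) \<and>
     (\<forall>a b U W. \<forall>k\<in>{1..ny g - 1}.
        T (\<lambda>l i. a * U l i + b * W l i) k = a * T U k + b * T W k)"

definition dissipative_boundary_operators ::
    "mesh \<Rightarrow> (nat \<Rightarrow> (nat \<Rightarrow> nat \<Rightarrow> complex) \<Rightarrow> nat \<Rightarrow> complex) \<Rightarrow> bool" where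
  "dissipative_boundary_operators g S \<longleftrightarrow>
     (\<forall>\<Phi> :: nat \<Rightarrow> nat \<Rightarrow> complex.
        (\<forall>k\<in>{0..ny g}. \<Phi> 0 k = 0) \<and> (\<forall>m. \<Phi> m 0 = 0 \<and> \<Phi> m (ny g) = 0) \<longrightarrow>
        (\<forall>M\<ge>1. Im (\<Sum>m = 1..M. inner_delta g (S m \<Phi>) (\<lambda>k. (\<Phi> (m - 1) k + \<Phi> m k) / 2)
                    * complex_of_real (step (tn g) m)) \<ge> 0))"

datatype splitting_factor = Cayley | Exponential

definition E_factor ::
    "splitting_factor \<Rightarrow> coefficients \<Rightarrow> mesh \<Rightarrow> nat \<Rightarrow> nat \<Rightarrow> nat \<Rightarrow> complex" where
  "E_factor f c g m j k = (case f of
     Cayley \<Rightarrow>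
       (1 - \<i> * complex_of_real (step (tn g) m / (4 * hbar c * rho_h c g j k) * Delta_V_h c g j k)) /
       (1 + \<i> * complex_of_real (step (tn g) m / (4 * hbar c * rho_h c g j k) * Delta_V_h c g j k))
   | Exponential \<Rightarrow>
       exp (- \<i> * complex_of_real (step (tn g) m / (2 * hbar c * rho_h c g j k) * Delta_V_h c g j k)))"

text \<open>
  The arguments \<open>P\<close>, \<open>Q\<close>, \<open>\<Psi>\<close> are the three mesh functions of the scheme: breve, tilde and
  unaccented, in this order. \<open>P\<close> and \<open>Q\<close> are only meaningful at time levels \<open>m \<ge> 1\<close>.
\<close>

definition scheme_solution ::
    "splitting_factor \<Rightarrow> coefficients \<Rightarrow> mesh \<Rightarrow>
     (nat \<Rightarrow> (nat \<Rightarrow> nat \<Rightarrow> complex) \<Rightarrow> nat \<Rightarrow> complex) \<Rightarrow> (nat \<Rightarrow> nat \<Rightarrow> nat \<Rightarrow> complex) \<Rightarrow>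
     (nat \<Rightarrow> nat \<Rightarrow> nat \<Rightarrow> complex) \<Rightarrow> (nat \<Rightarrow> nat \<Rightarrow> nat \<Rightarrow> complex) \<Rightarrow>
     (nat \<Rightarrow> nat \<Rightarrow> nat \<Rightarrow> complex) \<Rightarrow> bool" where
  "scheme_solution f c g S F P Q \<Psi> \<longleftrightarrow>
     eq_on_mesh g (\<Psi> 0) (Psi_init_h c g) \<and>
     (\<forall>m\<ge>1.
        let J = nx g; h = step (xn g) J; \<tau> = step (tn g) m;
            A = (\<lambda>j k. (Q m j k + P m j k) / 2);
            D = (\<lambda>j k. (Q m j k - P m j k) / complex_of_real \<tau>)
        in
        vanishes_on_Gamma g (P m) \<and> vanishes_on_Gamma g (Q m) \<and> vanishes_on_Gamma g (\<Psi> m) \<and>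
        (\<forall>j\<in>{1..J}. \<forall>k\<in>{1..ny g - 1}. P m j k = E_factor f c g m j k * \<Psi> (m - 1) j k) \<and>
        (\<forall>j\<in>{1..J - 1}. \<forall>k\<in>{1..ny g - 1}.
           \<i> * complex_of_real (hbar c * rho_h c g j k) * D j k =
           H0_h c g A j k + complex_of_real (V_aux_h c g j) * A j k + F m j k) \<and>
        (\<forall>j\<in>{1..J}. \<forall>k\<in>{1..ny g - 1}. \<Psi> m j k = E_factor f c g m j k * Q m j k) \<and>
        (\<forall>k\<in>{1..ny g - 1}.
           complex_of_real ((hbar c)\<^sup>2 / 2 * B1_inf c) * in_x (bar_d (xn g)) A J k
           - complex_of_real (h / 2) *
             (\<i> * complex_of_real (hbar c * rho_inf c) * D J k
              + (complex_of_real ((hbar c)\<^sup>2 / 2 * B2_inf c) *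
                   in_y (hat_d (yn g)) (in_y (bar_d (yn g)) A) J k
                 - complex_of_real (V_inf c) * A J k))
           + complex_of_real (h / 2) * F m J k
           = complex_of_real ((hbar c)\<^sup>2 / 2 * B1_inf c) * S m (\<lambda>l i. Q l J i) k))"

text \<open>\<open>Max\<close> from the library is meaningful for finite sets only.\<close>

definition maximum_of :: "(nat \<Rightarrow> real) \<Rightarrow> real \<Rightarrow> bool" where
  "maximum_of f v \<longleftrightarrow> (\<exists>m. f m = v) \<and> (\<forall>m. f m \<le> v)"

end

theory Submission
  imports Defs
begin

text \<open>
  The scheme is a Crank--Nicolson step with a symmetric Hamiltonian, enclosed between two
  multiplications by functions of modulus one; energy is lost only through the artificial boundary.

  To see this, the boundary condition at \<open>j = J\<close> is divided by \<open>h / 2\<close>. It then reads as the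
  equation of the half cell at \<open>x\<^sub>J\<close>: the same Crank--Nicolson equation as inside, with a
  Hamiltonian of its own and one additional term proportional to \<open>S m\<close>. The weights of the inner
  product over the closed mesh are the cell widths, with \<open>h / 2\<close> for this half cell, and the
  Hamiltonian extended to \<open>j = J\<close> is symmetric for that inner product
  (\<open>Im_hamiltonian_form\<close>): summation by parts in \<open>x\<close> leaves a term at \<open>x\<^sub>J\<close> which the half cell
  cancels, and the mixed derivatives leave none because \<open>B\<^sub>1\<^sub>2\<close> vanishes there. Testing the
  equation with the average of its two levels and taking imaginary parts, one obtains that the
  weighted mass of the tilde function minus that of the breve function is a multiple of the
  imaginary part of \<open>(F, average)\<close> minus a positive multiple of that of \<open>(S m \<dots>, average)\<close>
  (\<open>energy_balance\<close>).

  Everything follows from this balance. For \<open>F = 0\<close>, the potential steps preserve the mass and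
  are the identity at \<open>x\<^sub>J\<close>, because there the two potentials agree. So the averages at \<open>x\<^sub>J\<close> are the
  averages in time of a single boundary function with zero initial value, the balances of
  successive levels telescope, and the sum of the boundary terms has the sign assumed for \<open>S\<close>
  (\<open>mass_decay\<close>). For a single level, apply the same assumption to a boundary
  function that is zero before level \<open>m\<close>: the homogeneous level problem has mass at most zero, so
  only the trivial solution (\<open>level_problem_injective\<close>). A level has as many equations as
  unknowns, hence uniqueness gives solvability, and the levels are solved one after another.
\<close>

section \<open>Square linear systems\<close>

text \<open>
  Gaussian elimination, one unknown \<open>p\<close> at a time. Some equation \<open>q\<close> must contain \<open>p\<close>, otherwise
  the \<open>p\<close>-th unit vector would solve the homogeneous system. Eliminating \<open>p\<close> with the help of \<open>q\<close>
  leaves a system of the same kind with one unknown and one equation less. The sets of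
  equations and of unknowns are kept apart because the pair \<open>(q, p)\<close> removed need not be diagonal.
\<close>

lemma square_system_solvable:
  fixes a :: "'e \<Rightarrow> 'i \<Rightarrow> 'a::field"
  assumes "finite I" "finite E" "card I = card E"
    and "\<And>x. \<forall>e\<in>E. (\<Sum>i\<in>I. a e i * x i) = 0 \<Longrightarrow> \<forall>i\<in>I. x i = 0"
  shows "\<exists>x. \<forall>e\<in>E. (\<Sum>i\<in>I. a e i * x i) = b e"
  using assms
proof (induction I arbitrary: E a b rule: finite_induct)
  case empty
  then show ?case by auto
next
  case (insert p I)
  have "\<exists>q\<in>E. a q p \<noteq> 0"
  proof (rule ccontr)
    assume no_pivot: "\<not> (\<exists>q\<in>E. a q p \<noteq> 0)"
    have "(\<Sum>i\<in>insert p I. a e i * (if i = p then 1 else 0)) = 0" if "e \<in> E" for e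
      using no_pivot that insert.hyps by (intro sum.neutral) auto
    then show False
      using insert.prems(3)[of "\<lambda>i. if i = p then 1 else 0"] by auto
  qed
  then obtain q where q: "q \<in> E" "a q p \<noteq> 0" by blast
  define a' where "a' e i = a e i - a e p / a q p * a q i" for e i
  define b' where "b' e = b e - a e p / a q p * b q" for e
  \<comment> \<open>\<open>ext x s\<close> adds to \<open>x\<close> the value of the unknown \<open>p\<close> for which equation \<open>q\<close> has right side \<open>s\<close>.\<close>
  define ext where "ext x s = x(p := (s - (\<Sum>i\<in>I. a q i * x i)) / a q p)" for x s
  have sum_ext: "(\<Sum>i\<in>insert p I. a e i * ext x s i)
      = (\<Sum>i\<in>I. a' e i * x i) + a e p / a q p * s" for e x s
  proof -
    have "(\<Sum>i\<in>I. a e i * ext x s i) = (\<Sum>i\<in>I. a e i * x i)"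
      using insert.hyps by (intro sum.cong) (auto simp: ext_def)
    moreover have "(\<Sum>i\<in>I. a' e i * x i)
        = (\<Sum>i\<in>I. a e i * x i) - a e p / a q p * (\<Sum>i\<in>I. a q i * x i)"
      by (simp add: a'_def left_diff_distrib sum_subtractf sum_distrib_left mult.assoc)
    moreover have "(\<Sum>i\<in>insert p I. a e i * ext x s i) = a e p * ext x s p + (\<Sum>i\<in>I. a e i * ext x s i)"
      using insert.hyps by simp
    moreover have "a e p * ext x s p = a e p / a q p * s - a e p / a q p * (\<Sum>i\<in>I. a q i * x i)"
      by (simp add: ext_def diff_divide_distrib right_diff_distrib)
    ultimately show ?thesis by simp
  qed
  have pivot_row: "(\<Sum>i\<in>I. a' q i * x i) = 0" for x
    using q by (simp add: a'_def)
  have "\<exists>x. \<forall>e\<in>E - {q}. (\<Sum>i\<in>I. a' e i * x i) = b' e"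
  proof (rule insert.IH)
    show "finite (E - {q})" "card I = card (E - {q})"
      using insert q by auto
  next
    fix x assume x: "\<forall>e\<in>E - {q}. (\<Sum>i\<in>I. a' e i * x i) = 0"
    have "(\<Sum>i\<in>insert p I. a e i * ext x 0 i) = 0" if "e \<in> E" for e
      using x that pivot_row by (cases "e = q") (auto simp: sum_ext)
    then have "\<forall>i\<in>insert p I. ext x 0 i = 0"
      using insert.prems(3) by blast
    moreover have "ext x 0 i = x i" if "i \<in> I" for i
      using insert.hyps that by (auto simp: ext_def)
    ultimately show "\<forall>i\<in>I. x i = 0" by auto
  qed
  then obtain x where x: "\<forall>e\<in>E - {q}. (\<Sum>i\<in>I. a' e i * x i) = b' e" by blast
  have "(\<Sum>i\<in>insert p I. a e i * ext x (b q) i) = b e" if "e \<in> E" for e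
    using x that q pivot_row by (cases "e = q") (auto simp: sum_ext b'_def)
  then show ?case by blast
qed

text \<open>
  The previous lemma for an operator that is not given by a matrix. Only functions supported in
  \<open>I\<close> are considered, and linearity is required of the values on \<open>I\<close> alone, so that \<open>L\<close> may be the
  residual of a mesh problem with arbitrary values off the mesh.
\<close>

lemma injective_imp_solvable:
  fixes L :: "('i \<Rightarrow> 'a::field) \<Rightarrow> 'i \<Rightarrow> 'a"
  assumes "finite I"
    and lin: "\<And>a b U W e. e \<in> I \<Longrightarrow> L (\<lambda>i. a * U i + b * W i) e = a * L U e + b * L W e"
    and inj: "\<And>U. \<forall>i. i \<notin> I \<longrightarrow> U i = 0 \<Longrightarrow> \<forall>e\<in>I. L U e = 0 \<Longrightarrow> \<forall>i\<in>I. U i = 0"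
  shows "\<exists>U. (\<forall>i. i \<notin> I \<longrightarrow> U i = 0) \<and> (\<forall>e\<in>I. L U e = b e)"
proof -
  define d where "d i = (\<lambda>i'. if i' = i then 1 else 0 :: 'a)" for i :: 'i
  have expand: "L (\<lambda>i'. \<Sum>i\<in>A. x i * d i i') e = (\<Sum>i\<in>A. L (d i) e * x i)"
    if "finite A" "e \<in> I" for A x e
    using that(1)
  proof (induction A rule: finite_induct)
    case empty
    then show ?case using lin[OF that(2), of 0 "\<lambda>_. 0" 0 "\<lambda>_. 0"] by simp
  next
    case (insert i A)
    then show ?case
      using lin[OF that(2), of "x i" "d i" 1 "\<lambda>i'. \<Sum>i\<in>A. x i * d i i'"]
      by (simp add: mult.commute)
  qed
  define cut where "cut x = (\<lambda>i'. \<Sum>i\<in>I. x i * d i i')" for x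
  have cut: "cut x i = (if i \<in> I then x i else 0)" for x i
  proof -
    have "x i' * d i' i = (if i = i' then x i' else 0)" for i' by (simp add: d_def)
    then show ?thesis using assms(1) by (simp add: cut_def)
  qed
  have L_cut: "L (cut x) e = (\<Sum>i\<in>I. L (d i) e * x i)" if "e \<in> I" for x e
    unfolding cut_def by (rule expand[OF assms(1) that])
  have "\<exists>x. \<forall>e\<in>I. (\<Sum>i\<in>I. L (d i) e * x i) = b e"
  proof (rule square_system_solvable[OF assms(1) assms(1) refl])
    fix x assume "\<forall>e\<in>I. (\<Sum>i\<in>I. L (d i) e * x i) = 0"
    then have "\<forall>e\<in>I. L (cut x) e = 0" by (simp add: L_cut)
    then have "\<forall>i\<in>I. cut x i = 0"
      using inj[of "cut x"] by (simp add: cut)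
    then show "\<forall>i\<in>I. x i = 0" by (simp add: cut)
  qed
  then obtain x where "\<forall>e\<in>I. (\<Sum>i\<in>I. L (d i) e * x i) = b e" by blast
  then show ?thesis by (intro exI[of _ "cut x"]) (auto simp: cut L_cut)
qed

section \<open>Summation by parts on a nonuniform mesh\<close>

lemma half_step_pos:
  assumes "z (j - 1) < z j" "z j < z (j + 1)"
  shows "half_step z j > 0"
  using assms by (simp add: half_step_def step_def)

text \<open>
  Abel summation. The two mesh derivatives are adjoint up to sign because each is divided by the
  step with which its own inner product is weighted. The term at the last node is kept: on the
  artificial boundary it does not vanish.
\<close>

lemma sum_hat_d_by_parts:
  fixes a u :: "nat \<Rightarrow> complex"
  assumes "\<And>j. 1 \<le> j \<Longrightarrow> j \<le> n \<Longrightarrow> z (j - 1) < z j" and "u 0 = 0" and "n \<ge> 1"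
  shows "(\<Sum>j = 1..n - 1. hat_d z a j * u j * of_real (half_step z j)) - a n * u n
       = - (\<Sum>j = 1..n. a j * bar_d z u j * of_real (step z j))"
proof -
  have telescope: "(\<Sum>j = 1..m. (a (Suc j) - a j) * u j)
      = a (Suc m) * u m - (\<Sum>j = 1..m. a j * (u j - u (j - 1)))" for m
    using assms(2) by (induction m) (auto simp: algebra_simps)
  have interior: "hat_d z a j * u j * of_real (half_step z j) = (a (Suc j) - a j) * u j"
    if "j \<in> {1..n - 1}" for j
  proof -
    have "half_step z j > 0"
      using that assms(1)[of j] assms(1)[of "j + 1"] by (intro half_step_pos) auto
    then show ?thesis by (simp add: hat_d_def scaleR_conv_of_real)
  qed
  have edge: "a j * bar_d z u j * of_real (step z j) = a j * (u j - u (j - 1))"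
    if "j \<in> {1..n}" for j
    using that assms(1)[of j] by (simp add: bar_d_def scaleR_conv_of_real step_def flip: of_real_diff)
  obtain m where n: "n = Suc m" using assms(3) by (cases n) auto
  have lhs: "(\<Sum>j = 1..n - 1. hat_d z a j * u j * of_real (half_step z j))
      = (\<Sum>j = 1..m. (a (Suc j) - a j) * u j)"
    using interior by (intro sum.cong) (auto simp: n)
  have rhs: "(\<Sum>j = 1..n. a j * bar_d z u j * of_real (step z j))
      = (\<Sum>j = 1..Suc m. a j * (u j - u (j - 1)))"
    using edge by (intro sum.cong) (auto simp: n)
  show ?thesis unfolding lhs rhs telescope by (simp add: n algebra_simps)
qed

text \<open>
  The two mesh averages are adjoint in the same way. The boundary
  term is now the half of the last cell that adjoins its right end point, assumed to be zero.
\<close>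

lemma sum_hat_s_by_parts:
  fixes a u :: "nat \<Rightarrow> complex"
  assumes "\<And>j. 1 \<le> j \<Longrightarrow> j \<le> n \<Longrightarrow> z (j - 1) < z j" and "u 0 = 0" and "n \<ge> 1"
    and "a n * u n = 0"
  shows "(\<Sum>j = 1..n - 1. hat_s z a j * u j * of_real (half_step z j))
       = (\<Sum>j = 1..n. a j * bar_s u j * of_real (step z j))"
proof -
  have shift: "(\<Sum>j = 1..m. (step z j *\<^sub>R a j + step z (Suc j) *\<^sub>R a (Suc j)) * u j)
      = (\<Sum>j = 1..m. step z j *\<^sub>R a j * (u j + u (j - 1))) + step z (Suc m) *\<^sub>R a (Suc m) * u m" for m
    using assms(2) by (induction m) (auto simp: algebra_simps)
  have interior: "hat_s z a j * u j * of_real (half_step z j)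
      = (step z j *\<^sub>R a j + step z (Suc j) *\<^sub>R a (Suc j)) * u j / 2"
    if "j \<in> {1..n - 1}" for j
  proof -
    have "half_step z j > 0"
      using that assms(1)[of j] assms(1)[of "j + 1"] by (intro half_step_pos) auto
    then show ?thesis by (simp add: hat_s_def scaleR_conv_of_real field_simps)
  qed
  obtain m where n: "n = Suc m" using assms(3) by (cases n) auto
  have lhs: "(\<Sum>j = 1..n - 1. hat_s z a j * u j * of_real (half_step z j))
      = (\<Sum>j = 1..m. (step z j *\<^sub>R a j + step z (Suc j) *\<^sub>R a (Suc j)) * u j) / 2"
    unfolding sum_divide_distrib using interior by (intro sum.cong) (auto simp: n)
  have rhs: "(\<Sum>j = 1..n. a j * bar_s u j * of_real (step z j))
      = (\<Sum>j = 1..Suc m. step z j *\<^sub>R a j * (u j + u (j - 1))) / 2"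
    unfolding sum_divide_distrib
    by (intro sum.cong) (auto simp: n bar_s_def scaleR_conv_of_real field_simps)
  have "a (Suc m) * u (Suc m) = 0" using assms(4) n by simp
  then show ?thesis
    unfolding lhs rhs shift by (simp add: distrib_left)
qed

lemma cnj_bar_d: "cnj (bar_d z u j) = bar_d z (\<lambda>j. cnj (u j)) j"
  by (simp add: bar_d_def)

lemma cnj_bar_s: "cnj (bar_s u j) = bar_s (\<lambda>j. cnj (u j)) j"
  by (simp add: bar_s_def)

lemma bar_s_bar_d_commute:
  fixes W :: "nat \<Rightarrow> nat \<Rightarrow> complex"
  shows "bar_s (\<lambda>k. bar_d z (\<lambda>j. W j k) j) k = bar_d z (\<lambda>j. bar_s (W j) k) j"
  by (simp add: bar_s_def bar_d_def scaleR_conv_of_real algebra_simps)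

lemma bar_d_bar_s_commute:
  fixes W :: "nat \<Rightarrow> nat \<Rightarrow> complex"
  shows "bar_d z (\<lambda>k. bar_s (\<lambda>j. W j k) j) k = bar_s (\<lambda>j. bar_d z (W j) k) j"
  by (simp add: bar_s_def bar_d_def scaleR_conv_of_real algebra_simps)

lemma hat_s_pos:
  fixes a :: "nat \<Rightarrow> real"
  assumes "z (j - 1) < z j" "z j < z (j + 1)" "a j > 0" "a (j + 1) > 0"
  shows "hat_s z a j > 0"
proof -
  have "step z j * a j + step z (j + 1) * a (j + 1) > 0"
    using assms by (intro add_pos_pos mult_pos_pos) (auto simp: step_def)
  then show ?thesis using half_step_pos[OF assms(1,2)] by (simp add: hat_s_def)
qed

lemma hat_s_const:
  fixes a :: "nat \<Rightarrow> real"
  assumes "z (j - 1) < z j" "z j < z (j + 1)" "a j = v" "a (j + 1) = v"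
  shows "hat_s z a j = v"
proof -
  have "step z j + step z (j + 1) = 2 * half_step z j" by (simp add: half_step_def)
  moreover have "step z j * v + step z (j + 1) * v = (step z j + step z (j + 1)) * v"
    by (simp add: algebra_simps)
  ultimately show ?thesis
    using half_step_pos[OF assms(1,2)] assms(3,4) by (simp add: hat_s_def)
qed

lemma sum_split_last:
  fixes F :: "nat \<Rightarrow> complex"
  shows "n \<ge> 1 \<Longrightarrow> (\<Sum>j = 1..n. F j) = (\<Sum>j = 1..n - 1. F j) + F n"
  by (cases n) auto

lemma Im_sum_sum_eq_0:
  assumes "\<And>j k. j \<in> A \<Longrightarrow> k \<in> B \<Longrightarrow> Im (F j k) = 0"
  shows "Im (\<Sum>j\<in>A. \<Sum>k\<in>B. F j k) = 0"
  using assms by (simp add: Im_sum)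

section \<open>Mesh weights and the coefficients near the artificial boundary\<close>

text \<open>The weights in \<open>x\<close> of \<open>inner_mesh\<close>, including the half cell at the artificial boundary.\<close>

definition cell_width :: "mesh \<Rightarrow> nat \<Rightarrow> real" where
  "cell_width g j = (if j = nx g then step (xn g) (nx g) / 2 else half_step (xn g) j)"

text \<open>The squared norm in the theorem, written without square roots.\<close>

definition mass :: "coefficients \<Rightarrow> mesh \<Rightarrow> (nat \<Rightarrow> nat \<Rightarrow> complex) \<Rightarrow> real" where
  "mass c g W = (\<Sum>j = 1..nx g. \<Sum>k = 1..ny g - 1.
     rho_h c g j k * (cmod (W j k))\<^sup>2 * (cell_width g j * half_step (yn g) k))"

text \<open>
  The boundary condition divided by \<open>h / 2\<close>, without its right-hand side and its time difference.
  It discretizes the differential operator with the constant coefficients at infinity on the half cell left of \<open>x\<^sub>J\<close>, with zero flux through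
  \<open>x\<^sub>J\<close>: hence the single one-sided difference in \<open>x\<close> with factor \<open>2 / h\<close>.
\<close>

definition half_cell_hamiltonian ::
    "coefficients \<Rightarrow> mesh \<Rightarrow> (nat \<Rightarrow> nat \<Rightarrow> complex) \<Rightarrow> nat \<Rightarrow> nat \<Rightarrow> complex" where
  "half_cell_hamiltonian c g W j k =
     complex_of_real ((hbar c)\<^sup>2 / 2) *
       (of_real (2 / step (xn g) j) * (B11_h c g j k *\<^sub>R in_x (bar_d (xn g)) W j k)
        - of_real (B2_inf c) * in_y (hat_d (yn g)) (in_y (bar_d (yn g)) W) j k)
     + complex_of_real (V_inf c) * W j k"

definition hamiltonian ::
    "coefficients \<Rightarrow> mesh \<Rightarrow> (nat \<Rightarrow> nat \<Rightarrow> complex) \<Rightarrow> nat \<Rightarrow> nat \<Rightarrow> complex" where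
  "hamiltonian c g W j k =
     (if j = nx g then half_cell_hamiltonian c g W j k
      else H0_h c g W j k + complex_of_real (V_aux_h c g j) * W j k)"

text \<open>
  The flux through \<open>x\<^sub>J\<close> prescribed by the transparent boundary condition, after the same division
  by \<open>h / 2\<close>, as a source term living on the last column of the mesh.
\<close>

definition boundary_flux :: "coefficients \<Rightarrow> mesh \<Rightarrow> (nat \<Rightarrow> complex) \<Rightarrow> nat \<Rightarrow> nat \<Rightarrow> complex" where
  "boundary_flux c g s j k =
     (if j = nx g then complex_of_real ((hbar c)\<^sup>2 * B1_inf c / step (xn g) (nx g)) * s k else 0)"

lemma linear_combination_mesh_operators:
  fixes a b :: complex
  shows "hat_d z (\<lambda>j. a * u j + b * w j) i = a * hat_d z u i + b * hat_d z w i"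
    and "bar_d z (\<lambda>j. a * u j + b * w j) i = a * bar_d z u i + b * bar_d z w i"
    and "hat_s z (\<lambda>j. a * u j + b * w j) i = a * hat_s z u i + b * hat_s z w i"
    and "bar_s (\<lambda>j. a * u j + b * w j) i = a * bar_s u i + b * bar_s w i"
    and "r *\<^sub>R (a * p + b * q) = a * (r *\<^sub>R p) + b * (r *\<^sub>R q)"
  by (simp_all add: hat_d_def bar_d_def hat_s_def bar_s_def scaleR_conv_of_real algebra_simps)

lemma H0_h_linear:
  "H0_h c g (\<lambda>j k. a * U j k + b * W j k) j k = a * H0_h c g U j k + b * H0_h c g W j k"
  unfolding H0_h_def in_x_def in_y_def linear_combination_mesh_operators
  by (simp only: distrib_left distrib_right mult.left_commute add_ac)

lemma hamiltonian_linear: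
  "hamiltonian c g (\<lambda>j k. a * U j k + b * W j k) j k
     = a * hamiltonian c g U j k + b * hamiltonian c g W j k"
  unfolding hamiltonian_def half_cell_hamiltonian_def H0_h_linear in_x_def in_y_def
    linear_combination_mesh_operators
  by (simp only: if_distrib algebra_simps split: if_split) (simp add: algebra_simps)

lemma linear_boundary_operatorD:
  assumes "linear_boundary_operator g m T" "k \<in> {1..ny g - 1}"
  shows "T (\<lambda>l i. a * U l i + b * W l i) k = a * T U k + b * T W k"
  using assms unfolding linear_boundary_operator_def by blast

lemma linear_boundary_operator_local:
  assumes "linear_boundary_operator g m T" "k \<in> {1..ny g - 1}"
    and "\<And>l k. l \<in> {1..m} \<Longrightarrow> k \<in> {1..ny g - 1} \<Longrightarrow> U l k = W l k"
  shows "T U k = T W k"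
  using assms unfolding linear_boundary_operator_def by blast

lemma boundary_flux_combination:
  assumes "s k = a * s1 k + b * s2 k"
  shows "boundary_flux c g s j k = a * boundary_flux c g s1 j k + b * boundary_flux c g s2 j k"
  using assms by (simp add: boundary_flux_def add_divide_distrib algebra_simps)

lemma eq_on_meshD:
  assumes "eq_on_mesh g U W" "j \<le> nx g" "k \<in> {1..ny g - 1}"
  shows "U j k = W j k"
  using assms by (auto simp: eq_on_mesh_def)

lemma cmod_E_factor: "cmod (E_factor f c g m j k) = 1"
proof (cases f)
  case Cayley
  have "cmod ((1 - \<i> * of_real r) / (1 + \<i> * of_real r)) = 1" for r :: real
  proof -
    have "1 + \<i> * of_real r \<noteq> 0" by (simp add: complex_eq_iff)
    moreover have "cmod (1 - \<i> * of_real r) = cmod (1 + \<i> * of_real r)"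
      by (simp add: cmod_def)
    ultimately show ?thesis by (simp add: norm_divide)
  qed
  then show ?thesis unfolding E_factor_def Cayley splitting_factor.case .
next
  case Exponential
  then show ?thesis by (simp add: E_factor_def norm_exp_eq_Re)
qed

text \<open>
  The time difference tested with the time average: the real part of
  \<open>(q - p) (q + p)\<^sup>*\<close> is a difference of squared moduli, and the factor \<open>\<i>\<close> turns it into an
  imaginary part.
\<close>

lemma Im_crank_nicolson_term:
  fixes p q :: complex
  assumes "\<tau> \<noteq> 0"
  shows "Im (\<i> * of_real r * ((q - p) / of_real \<tau>) * cnj ((q + p) / 2) * of_real w)
       = r / (2 * \<tau>) * ((cmod q)\<^sup>2 - (cmod p)\<^sup>2) * w"
proof -
  have factor: "\<i> * of_real r * ((q - p) / of_real \<tau>) * cnj ((q + p) / 2) * of_real w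
      = of_real (r / (2 * \<tau>) * w) * (\<i> * ((q - p) * cnj (q + p)))"
    using assms by (simp add: field_simps)
  have difference: "Re ((q - p) * cnj (q + p)) = (cmod q)\<^sup>2 - (cmod p)\<^sup>2"
    unfolding cmod_power2 by (simp add: power2_eq_square algebra_simps)
  have rotate: "Im (of_real t * (\<i> * z)) = t * Re z" for t z by simp
  show ?thesis unfolding factor rotate difference by (simp add: mult_ac)
qed

locale admissible_scheme =
  fixes c :: coefficients and g :: mesh
  assumes coeffs: "admissible_coefficients c" and mesh: "admissible_mesh c g"
begin

lemma hbar_pos: "hbar c > 0" and B1_pos: "B1_inf c > 0"
  using coeffs by (auto simp: admissible_coefficients_def)

lemma nx_ge: "2 \<le> nx g"
  using mesh by (simp add: admissible_mesh_def)

lemma ny_pos: "1 \<le> ny g"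
proof (rule ccontr)
  assume "\<not> 1 \<le> ny g"
  then have "ny g = 0" by simp
  then show False
    using mesh coeffs by (simp add: admissible_mesh_def admissible_coefficients_def)
qed

lemma x_less: "i < j \<Longrightarrow> xn g i < xn g j"
  using mesh by (simp add: admissible_mesh_def strict_mono_def)

lemma y_less: "i < k \<Longrightarrow> k \<le> ny g \<Longrightarrow> yn g i < yn g k"
  using mesh by (auto simp: admissible_mesh_def strict_mono_on_def)

lemma tau_pos: "m \<ge> 1 \<Longrightarrow> step (tn g) m > 0"
  using mesh by (simp add: admissible_mesh_def strict_mono_def step_def)

lemma x_step_pos: "j \<ge> 1 \<Longrightarrow> step (xn g) j > 0"
  using x_less[of "j - 1" j] by (simp add: step_def)

lemma half_step_y_pos: "k \<in> {1..ny g - 1} \<Longrightarrow> half_step (yn g) k > 0"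
  by (intro half_step_pos y_less) auto

lemma cell_width_pos: "j \<ge> 1 \<Longrightarrow> cell_width g j > 0"
  using x_step_pos[of "nx g"] nx_ge by (auto simp: cell_width_def intro!: half_step_pos x_less)

lemma midpoint_x_pos: "j \<ge> 1 \<Longrightarrow> (xn g (j - 1) + xn g j) / 2 > 0"
  using x_less[of 0 j] x_less[of 0 "j - 1"] mesh
  by (cases "j = 1") (auto simp: admissible_mesh_def)

text \<open>
  Two full cells left of \<open>x\<^sub>J\<close> lie beyond \<open>X\<^sub>0\<close>, so every coefficient sampled in a cell next to \<open>x\<^sub>J\<close>
  has its constant value at infinity.
\<close>

lemma midpoint_x_far: "j \<ge> nx g - 1 \<Longrightarrow> (xn g (j - 1) + xn g j) / 2 \<ge> X0 c"
proof -
  assume j: "j \<ge> nx g - 1"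
  have "xn g (nx g - 2) \<le> xn g (j - 1)"
    using j x_less[of "nx g - 2" "j - 1"] nx_ge by (cases "nx g - 2 = j - 1") fastforce+
  moreover have "xn g (j - 1) \<le> xn g j"
    using x_less[of "j - 1" j] by (cases j) auto
  moreover have "X0 c \<le> xn g (nx g - 2)" using mesh by (simp add: admissible_mesh_def)
  ultimately show ?thesis by simp
qed

lemma midpoint_y_range:
  assumes "k \<in> {1..ny g}"
  shows "0 < (yn g (k - 1) + yn g k) / 2" "(yn g (k - 1) + yn g k) / 2 < wid c"
proof -
  have "yn g 0 = 0" "yn g (ny g) = wid c" using mesh by (auto simp: admissible_mesh_def)
  moreover have "yn g (k - 1) < yn g k" using assms by (intro y_less) auto
  moreover have "yn g 0 \<le> yn g (k - 1)"
    using y_less[of 0 "k - 1"] assms by (cases "k = 1") fastforce+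
  moreover have "yn g k \<le> yn g (ny g)"
    using y_less[of k "ny g"] assms by (cases "k = ny g") auto
  ultimately show "0 < (yn g (k - 1) + yn g k) / 2" "(yn g (k - 1) + yn g k) / 2 < wid c"
    by auto
qed

lemma rho_h_pos:
  assumes "j \<in> {1..nx g}" "k \<in> {1..ny g - 1}"
  shows "rho_h c g j k > 0"
proof -
  have "midpoint_value g (rho c) i l > 0" if "i \<ge> 1" "l \<in> {1..ny g}" for i l
  proof -
    obtain r where "r > 0" "\<forall>x>0. \<forall>y. 0 < y \<and> y < wid c \<longrightarrow> rho c x y \<ge> r"
      using coeffs by (auto simp: admissible_coefficients_def)
    then show ?thesis
      using midpoint_x_pos[OF that(1)] midpoint_y_range[OF that(2)]
      unfolding midpoint_value_def by (meson less_le_trans)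
  qed
  then show ?thesis
    unfolding rho_h_def in_x_def in_y_def
    using assms by (intro hat_s_pos x_less y_less) auto
qed

lemma rho_h_far:
  assumes "k \<in> {1..ny g - 1}"
  shows "rho_h c g (nx g) k = rho_inf c"
proof -
  have "midpoint_value g (rho c) i l = rho_inf c" if "i \<ge> nx g" "l \<in> {1..ny g}" for i l
    using coeffs midpoint_x_far[of i] midpoint_y_range[OF that(2)] that(1)
    by (simp add: midpoint_value_def admissible_coefficients_def)
  then show ?thesis
    unfolding rho_h_def in_x_def in_y_def
    using assms nx_ge by (intro hat_s_const x_less y_less) auto
qed

text \<open>
  Splitting off the potential does nothing at \<open>x\<^sub>J\<close>. Without this, the breve function at \<open>x\<^sub>J\<close> would
  not be the tilde function of the previous level, and the averages in the energy balance would
  not be those in the assumption on \<open>S\<close>.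
\<close>

lemma Delta_V_h_far:
  assumes "k \<in> {1..ny g - 1}"
  shows "Delta_V_h c g (nx g) k = 0"
proof -
  have "midpoint_value g (pot c) i l = V_inf c" if "i \<ge> nx g" "l \<in> {1..ny g}" for i l
    using coeffs midpoint_x_far[of i] midpoint_y_range[OF that(2)] that(1)
    by (simp add: midpoint_value_def admissible_coefficients_def)
  then have "V_h c g (nx g) k = V_inf c"
    unfolding V_h_def in_x_def in_y_def
    using assms nx_ge by (intro hat_s_const x_less y_less) auto
  moreover have "V_aux_h c g (nx g) = V_inf c"
    unfolding V_aux_h_def
    using coeffs midpoint_x_far[of "nx g"] midpoint_x_far[of "nx g + 1"] nx_ge
    by (intro hat_s_const x_less) (auto simp: admissible_coefficients_def)
  ultimately show ?thesis by (simp add: Delta_V_h_def)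
qed

lemma B11_h_far:
  assumes "k \<in> {1..ny g - 1}"
  shows "B11_h c g (nx g) k = B1_inf c"
proof -
  have "midpoint_value g (\<lambda>x y. Bmat c x y $ 1 $ 1) (nx g) l = B1_inf c"
    if "l \<in> {1..ny g}" for l
    using coeffs midpoint_x_far[of "nx g"] midpoint_y_range[OF that]
    by (simp add: midpoint_value_def admissible_coefficients_def)
  then show ?thesis
    unfolding B11_h_def in_x_def in_y_def
    using assms by (intro hat_s_const y_less) auto
qed

lemma B12_h_far:
  assumes "k \<in> {1..ny g}"
  shows "B12_h c g (nx g) k = 0"
  using coeffs midpoint_x_far[of "nx g"] midpoint_y_range[OF assms]
  by (simp add: B12_h_def midpoint_value_def admissible_coefficients_def)

lemma B21_h_eq_B12_h:
  assumes "j \<ge> 1" "k \<in> {1..ny g}"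
  shows "B21_h c g j k = B12_h c g j k"
proof -
  let ?B = "Bmat c ((xn g (j - 1) + xn g j) / 2) ((yn g (k - 1) + yn g k) / 2)"
  have "transpose ?B = ?B"
    using coeffs midpoint_x_pos[OF assms(1)] midpoint_y_range[OF assms(2)]
    by (simp add: admissible_coefficients_def)
  then have "transpose ?B $ 1 $ 2 = ?B $ 1 $ 2" by simp
  then show ?thesis by (simp add: B21_h_def B12_h_def midpoint_value_def transpose_def)
qed

lemma inner_mesh_weights:
  "inner_mesh g U W = (\<Sum>j = 1..nx g. \<Sum>k = 1..ny g - 1. U j k * cnj (W j k) *
     complex_of_real (cell_width g j * half_step (yn g) k))"
proof -
  obtain n where n: "nx g = Suc n" using nx_ge by (cases "nx g") auto
  then show ?thesis by (simp add: inner_mesh_def cell_width_def)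
qed

lemma norm_mesh_mass:
  "norm_mesh g (\<lambda>j k. complex_of_real (sqrt (rho_h c g j k)) * W j k) = sqrt (mass c g W)"
proof -
  have "Re (complex_of_real (sqrt (rho_h c g j k)) * W j k
        * cnj (complex_of_real (sqrt (rho_h c g j k)) * W j k) * complex_of_real w)
      = rho_h c g j k * (cmod (W j k))\<^sup>2 * w"
    if "j \<in> {1..nx g}" "k \<in> {1..ny g - 1}" for j k w
  proof -
    have "(cmod (complex_of_real (sqrt (rho_h c g j k)) * W j k))\<^sup>2
        = rho_h c g j k * (cmod (W j k))\<^sup>2"
      using rho_h_pos[OF that] by (simp add: norm_mult power_mult_distrib)
    then show ?thesis
      by (metis Re_complex_of_real complex_norm_square of_real_mult)
  qed
  then show ?thesis
    unfolding norm_mesh_def inner_mesh_weights mass_def Re_sum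
    by (intro arg_cong[of _ _ sqrt] sum.cong refl) auto
qed

lemma mass_cong:
  assumes "\<And>j k. j \<in> {1..nx g} \<Longrightarrow> k \<in> {1..ny g - 1} \<Longrightarrow> cmod (U j k) = cmod (W j k)"
  shows "mass c g U = mass c g W"
  unfolding mass_def using assms by (intro sum.cong refl) auto

lemma mass_eq_0_imp:
  assumes "mass c g W \<le> 0" "j \<in> {1..nx g}" "k \<in> {1..ny g - 1}"
  shows "W j k = 0"
proof -
  let ?t = "\<lambda>j k. rho_h c g j k * (cmod (W j k))\<^sup>2 * (cell_width g j * half_step (yn g) k)"
  have nonneg: "?t j k \<ge> 0" if "j \<in> {1..nx g}" "k \<in> {1..ny g - 1}" for j k
    using rho_h_pos[OF that] cell_width_pos[of j] half_step_y_pos[OF that(2)] that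
    by (intro mult_nonneg_nonneg) auto
  have "mass c g W \<ge> 0"
    unfolding mass_def using nonneg by (intro sum_nonneg) auto
  then have "(\<Sum>j = 1..nx g. \<Sum>k = 1..ny g - 1. ?t j k) = 0"
    using assms(1) by (simp add: mass_def)
  then have "(\<Sum>k = 1..ny g - 1. ?t j k) = 0"
    using assms(2) nonneg by (subst (asm) sum_nonneg_eq_0_iff) (auto intro!: sum_nonneg)
  then have "?t j k = 0"
    using assms(2,3) nonneg by (subst (asm) sum_nonneg_eq_0_iff) auto
  then show ?thesis
    using rho_h_pos[OF assms(2,3)] cell_width_pos[of j] half_step_y_pos[OF assms(3)] assms(2)
    by auto
qed

section \<open>Symmetry of the Hamiltonian\<close>

text \<open>
  The cell width absorbs the denominators of the operators in \<open>x\<close>. What remains are four terms, one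
  for each coefficient of \<open>B\<close>. On the last column the first is the boundary term produced by its
  summation by parts, the mixed ones are absent, and the fourth has its coefficient at infinity.
\<close>

lemma hamiltonian_split:
  assumes "j \<in> {1..nx g}" "k \<in> {1..ny g - 1}"
  shows "hamiltonian c g W j k * complex_of_real (cell_width g j) =
    - complex_of_real ((hbar c)\<^sup>2 / 2) *
     ((if j = nx g then - (B11_h c g j k *\<^sub>R in_x (bar_d (xn g)) W j k)
       else in_x (hat_d (xn g)) (\<lambda>j k. B11_h c g j k *\<^sub>R in_x (bar_d (xn g)) W j k) j k
         * of_real (half_step (xn g) j))
    + (if j = nx g then 0 else in_x (hat_d (xn g)) (in_y (hat_s (yn g))
         (\<lambda>j k. B12_h c g j k *\<^sub>R in_x bar_s (in_y (bar_d (yn g)) W) j k)) j k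
         * of_real (half_step (xn g) j))
    + (if j = nx g then 0 else in_x (hat_s (xn g)) (in_y (hat_d (yn g))
         (\<lambda>j k. B21_h c g j k *\<^sub>R in_x (bar_d (xn g)) (in_y bar_s W) j k)) j k
         * of_real (half_step (xn g) j))
    + in_y (hat_d (yn g)) (\<lambda>j k. (if j = nx g then B2_inf c else B22_h c g j k)
         *\<^sub>R in_y (bar_d (yn g)) W j k) j k * of_real (cell_width g j))
    + complex_of_real ((if j = nx g then V_inf c else V_aux_h c g j) * cell_width g j) * W j k"
proof (cases "j = nx g")
  case True
  have nz: "step (xn g) (nx g) \<noteq> 0" using x_step_pos[of "nx g"] nx_ge by simp
  have B2: "in_y (hat_d (yn g)) (\<lambda>j k. (if j = nx g then B2_inf c else B22_h c g j k)
         *\<^sub>R in_y (bar_d (yn g)) W j k) j k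
      = of_real (B2_inf c) * in_y (hat_d (yn g)) (in_y (bar_d (yn g)) W) j k"
    using True by (simp add: in_y_def hat_d_def scaleR_conv_of_real right_diff_distrib)
  have half_cell: "(C * (of_real (2 / h) * T - b * Y) + of_real v * w) * of_real (h / 2)
      = - C * (- T + 0 + 0 + b * Y * of_real (h / 2)) + of_real (v * (h / 2)) * w"
    if "h \<noteq> 0" for C T b Y w :: complex and h v :: real
    using that by (simp add: field_simps)
  show ?thesis
    unfolding B2 hamiltonian_def half_cell_hamiltonian_def cell_width_def
    unfolding True by (simp only: refl if_True half_cell[OF nz])
next
  case False
  have B2: "in_y (hat_d (yn g)) (\<lambda>j k. (if j = nx g then B2_inf c else B22_h c g j k)
         *\<^sub>R in_y (bar_d (yn g)) W j k) j k
      = in_y (hat_d (yn g)) (\<lambda>j k. B22_h c g j k *\<^sub>R in_y (bar_d (yn g)) W j k) j k"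
    using False by (simp add: in_y_def)
  show ?thesis
    unfolding B2 hamiltonian_def H0_h_def cell_width_def
    using False by (simp add: algebra_simps)
qed

text \<open>
  The one-sided difference on the last column is exactly the boundary term of the summation by
  parts, so none is left over.
\<close>

lemma x_difference_by_parts:
  assumes "vanishes_on_Gamma g u" "k \<in> {1..ny g - 1}"
  shows "(\<Sum>j = 1..nx g. (if j = nx g then - a j k
            else in_x (hat_d (xn g)) a j k * of_real (half_step (xn g) j)) * u j k)
       = - (\<Sum>j = 1..nx g. a j k * in_x (bar_d (xn g)) u j k * of_real (step (xn g) j))"
proof -
  have "u 0 k = 0" using assms by (simp add: vanishes_on_Gamma_def)
  then have "(\<Sum>j = 1..nx g - 1. hat_d (xn g) (\<lambda>j. a j k) j * u j k * of_real (half_step (xn g) j))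
        - a (nx g) k * u (nx g) k
      = - (\<Sum>j = 1..nx g. a j k * bar_d (xn g) (\<lambda>j. u j k) j * of_real (step (xn g) j))"
    using nx_ge by (intro sum_hat_d_by_parts x_less) auto
  moreover have "(\<Sum>j = 1..nx g - 1. (if j = nx g then - a j k
            else in_x (hat_d (xn g)) a j k * of_real (half_step (xn g) j)) * u j k)
      = (\<Sum>j = 1..nx g - 1. hat_d (xn g) (\<lambda>j. a j k) j * u j k * of_real (half_step (xn g) j))"
    using nx_ge by (intro sum.cong refl) (auto simp: in_x_def)
  ultimately show ?thesis
    using nx_ge by (subst sum_split_last) (auto simp: in_x_def)
qed

lemma y_difference_by_parts:
  fixes a u :: "nat \<Rightarrow> nat \<Rightarrow> complex"
  assumes "u j 0 = 0" "u j (ny g) = 0"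
  shows "(\<Sum>k = 1..ny g - 1. in_y (hat_d (yn g)) a j k * u j k * of_real (half_step (yn g) k))
       = - (\<Sum>k = 1..ny g. a j k * in_y (bar_d (yn g)) u j k * of_real (step (yn g) k))"
  using sum_hat_d_by_parts[of "ny g" "yn g" "u j" "a j"] assms ny_pos
  by (simp add: in_y_def y_less)

text \<open>
  Derivative in \<open>x\<close> of an average in \<open>y\<close>: sum by parts along each row, then along each column. The
  function \<open>a\<close> will contain the factor \<open>B\<^sub>1\<^sub>2\<close>, which vanishes on the last column and removes the
  boundary term at \<open>x\<^sub>J\<close>.
\<close>

lemma xy_difference_by_parts:
  assumes u: "vanishes_on_Gamma g u" and far: "\<And>k. k \<in> {1..ny g} \<Longrightarrow> a (nx g) k = 0"
  shows "(\<Sum>j = 1..nx g. \<Sum>k = 1..ny g - 1. (if j = nx g then 0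
            else in_x (hat_d (xn g)) (in_y (hat_s (yn g)) a) j k * of_real (half_step (xn g) j))
            * u j k * of_real (half_step (yn g) k))
       = - (\<Sum>j = 1..nx g. \<Sum>k = 1..ny g. a j k * in_y bar_s (in_x (bar_d (xn g)) u) j k
            * of_real (step (xn g) j * step (yn g) k))"
proof -
  let ?s = "in_y (hat_s (yn g)) a"
  have s_far: "?s (nx g) k = 0" if "k \<in> {1..ny g - 1}" for k
  proof -
    have "k \<in> {1..ny g}" "k + 1 \<in> {1..ny g}" using that ny_pos by auto
    then show ?thesis using far by (simp add: in_y_def hat_s_def)
  qed
  have x_parts: "(\<Sum>j = 1..nx g. (if j = nx g then 0
            else in_x (hat_d (xn g)) ?s j k * of_real (half_step (xn g) j)) * u j k)
       = - (\<Sum>j = 1..nx g. ?s j k * in_x (bar_d (xn g)) u j k * of_real (step (xn g) j))"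
    if "k \<in> {1..ny g - 1}" for k
    using x_difference_by_parts[OF u that, of ?s] s_far[OF that] by (simp cong: if_cong)
  have y_parts: "(\<Sum>k = 1..ny g - 1. ?s j k * in_x (bar_d (xn g)) u j k * of_real (half_step (yn g) k))
      = (\<Sum>k = 1..ny g. a j k * in_y bar_s (in_x (bar_d (xn g)) u) j k * of_real (step (yn g) k))"
    if "j \<in> {1..nx g}" for j
  proof -
    have "in_x (bar_d (xn g)) u j 0 = 0" "in_x (bar_d (xn g)) u j (ny g) = 0"
      using u that by (auto simp: vanishes_on_Gamma_def in_x_def bar_d_def)
    then show ?thesis
      using sum_hat_s_by_parts[of "ny g" "yn g" "in_x (bar_d (xn g)) u j" "a j"] ny_pos
      by (simp add: in_y_def y_less)
  qed
  have "(\<Sum>j = 1..nx g. \<Sum>k = 1..ny g - 1. (if j = nx g then 0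
            else in_x (hat_d (xn g)) ?s j k * of_real (half_step (xn g) j))
            * u j k * of_real (half_step (yn g) k))
      = (\<Sum>k = 1..ny g - 1. (\<Sum>j = 1..nx g. (if j = nx g then 0
            else in_x (hat_d (xn g)) ?s j k * of_real (half_step (xn g) j)) * u j k)
            * of_real (half_step (yn g) k))"
    by (subst sum.swap) (simp add: sum_distrib_right)
  also have "\<dots> = (\<Sum>k = 1..ny g - 1.
      - (\<Sum>j = 1..nx g. ?s j k * in_x (bar_d (xn g)) u j k * of_real (step (xn g) j))
            * of_real (half_step (yn g) k))"
    using x_parts by (intro sum.cong refl) auto
  also have "\<dots> = - (\<Sum>j = 1..nx g. (\<Sum>k = 1..ny g - 1.
      ?s j k * in_x (bar_d (xn g)) u j k * of_real (half_step (yn g) k)) * of_real (step (xn g) j))"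
    unfolding sum_distrib_right sum_negf[symmetric]
    by (subst sum.swap) (simp add: sum_negf sum_distrib_right mult_ac)
  also have "\<dots> = - (\<Sum>j = 1..nx g. (\<Sum>k = 1..ny g.
      a j k * in_y bar_s (in_x (bar_d (xn g)) u) j k * of_real (step (yn g) k)) * of_real (step (xn g) j))"
    using y_parts by (intro arg_cong[of _ _ uminus] sum.cong refl) auto
  finally show ?thesis by (simp add: sum_distrib_left mult_ac)
qed

lemma yx_difference_by_parts:
  assumes u: "vanishes_on_Gamma g u" and far: "\<And>k. k \<in> {1..ny g} \<Longrightarrow> a (nx g) k = 0"
  shows "(\<Sum>j = 1..nx g. \<Sum>k = 1..ny g - 1. (if j = nx g then 0
            else in_x (hat_s (xn g)) (in_y (hat_d (yn g)) a) j k * of_real (half_step (xn g) j))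
            * u j k * of_real (half_step (yn g) k))
       = - (\<Sum>j = 1..nx g. \<Sum>k = 1..ny g. a j k * in_y (bar_d (yn g)) (in_x bar_s u) j k
            * of_real (step (xn g) j * step (yn g) k))"
proof -
  let ?d = "in_y (hat_d (yn g)) a"
  have x_parts: "(\<Sum>j = 1..nx g. (if j = nx g then 0
            else in_x (hat_s (xn g)) ?d j k * of_real (half_step (xn g) j)) * u j k)
       = (\<Sum>j = 1..nx g. ?d j k * in_x bar_s u j k * of_real (step (xn g) j))"
    if k: "k \<in> {1..ny g - 1}" for k
  proof -
    have "?d (nx g) k = 0"
    proof -
      have "k \<in> {1..ny g}" "k + 1 \<in> {1..ny g}" using k ny_pos by auto
      then show ?thesis using far by (simp add: in_y_def hat_d_def)
    qed
    moreover have "u 0 k = 0" using u k by (simp add: vanishes_on_Gamma_def)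
    ultimately have "(\<Sum>j = 1..nx g - 1.
          hat_s (xn g) (\<lambda>j. ?d j k) j * u j k * of_real (half_step (xn g) j))
        = (\<Sum>j = 1..nx g. ?d j k * bar_s (\<lambda>j. u j k) j * of_real (step (xn g) j))"
      using nx_ge by (intro sum_hat_s_by_parts x_less) auto
    moreover have "(\<Sum>j = 1..nx g - 1. (if j = nx g then 0
          else in_x (hat_s (xn g)) ?d j k * of_real (half_step (xn g) j)) * u j k)
        = (\<Sum>j = 1..nx g - 1. hat_s (xn g) (\<lambda>j. ?d j k) j * u j k * of_real (half_step (xn g) j))"
      using nx_ge by (intro sum.cong refl) (auto simp: in_x_def)
    ultimately show ?thesis
      using nx_ge by (subst sum_split_last) (auto simp: in_x_def)
  qed
  have y_parts: "(\<Sum>k = 1..ny g - 1. ?d j k * in_x bar_s u j k * of_real (half_step (yn g) k))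
      = - (\<Sum>k = 1..ny g. a j k * in_y (bar_d (yn g)) (in_x bar_s u) j k * of_real (step (yn g) k))"
    if "j \<in> {1..nx g}" for j
    using u that
    by (intro y_difference_by_parts) (auto simp: vanishes_on_Gamma_def in_x_def bar_s_def)
  have "(\<Sum>j = 1..nx g. \<Sum>k = 1..ny g - 1. (if j = nx g then 0
            else in_x (hat_s (xn g)) ?d j k * of_real (half_step (xn g) j))
            * u j k * of_real (half_step (yn g) k))
      = (\<Sum>k = 1..ny g - 1. (\<Sum>j = 1..nx g. (if j = nx g then 0
            else in_x (hat_s (xn g)) ?d j k * of_real (half_step (xn g) j)) * u j k)
            * of_real (half_step (yn g) k))"
    by (subst sum.swap) (simp add: sum_distrib_right)
  also have "\<dots> = (\<Sum>k = 1..ny g - 1.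
      (\<Sum>j = 1..nx g. ?d j k * in_x bar_s u j k * of_real (step (xn g) j))
            * of_real (half_step (yn g) k))"
    using x_parts by (intro sum.cong refl) auto
  also have "\<dots> = (\<Sum>j = 1..nx g. (\<Sum>k = 1..ny g - 1.
      ?d j k * in_x bar_s u j k * of_real (half_step (yn g) k)) * of_real (step (xn g) j))"
    unfolding sum_distrib_right by (subst sum.swap) (simp add: mult_ac)
  also have "\<dots> = (\<Sum>j = 1..nx g. - (\<Sum>k = 1..ny g.
      a j k * in_y (bar_d (yn g)) (in_x bar_s u) j k * of_real (step (yn g) k)) * of_real (step (xn g) j))"
    using y_parts by (intro sum.cong refl) auto
  finally show ?thesis by (simp add: sum_distrib_left sum_negf mult_ac)
qed

text \<open>
  After summation by parts the contributions of \<open>B\<^sub>1\<^sub>1\<close> and \<open>B\<^sub>2\<^sub>2\<close> are real combinations of squared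
  moduli. The two mixed terms are \<open>B\<^sub>1\<^sub>2 X Y\<^sup>*\<close> and \<open>B\<^sub>2\<^sub>1 Y X\<^sup>*\<close> for the same cell derivatives \<open>X\<close>
  (in \<open>y\<close>) and \<open>Y\<close> (in \<open>x\<close>), hence conjugate to each other as \<open>B\<^sub>1\<^sub>2 = B\<^sub>2\<^sub>1\<close>; this
  uses that averaging in one variable commutes with the difference in the other.
\<close>

lemma Im_hamiltonian_form:
  assumes W: "vanishes_on_Gamma g W"
  shows "Im (inner_mesh g (hamiltonian c g W) W) = 0"
proof -
  let ?u = "\<lambda>j k. cnj (W j k)"
  let ?v = "\<lambda>j. if j = nx g then V_inf c else V_aux_h c g j"
  define X where "X = in_x bar_s (in_y (bar_d (yn g)) W)"
  define Y where "Y = in_x (bar_d (xn g)) (in_y bar_s W)"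
  define a where "a = (\<lambda>j k. B11_h c g j k *\<^sub>R in_x (bar_d (xn g)) W j k)"
  define p where "p = (\<lambda>j k. B12_h c g j k *\<^sub>R X j k)"
  define q where "q = (\<lambda>j k. B21_h c g j k *\<^sub>R Y j k)"
  define b where "b = (\<lambda>j k. (if j = nx g then B2_inf c else B22_h c g j k)
         *\<^sub>R in_y (bar_d (yn g)) W j k)"
  define T1 where "T1 j k = (if j = nx g then - a j k
         else in_x (hat_d (xn g)) a j k * of_real (half_step (xn g) j))" for j k
  define T2 where "T2 j k = (if j = nx g then 0
         else in_x (hat_d (xn g)) (in_y (hat_s (yn g)) p) j k * of_real (half_step (xn g) j))" for j k
  define T3 where "T3 j k = (if j = nx g then 0
         else in_x (hat_s (xn g)) (in_y (hat_d (yn g)) q) j k * of_real (half_step (xn g) j))" for j k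
  define T4 where "T4 j k = in_y (hat_d (yn g)) b j k * of_real (cell_width g j)" for j k
  define \<Sigma> where "\<Sigma> F = (\<Sum>j = 1..nx g. \<Sum>k = 1..ny g - 1. F j k * ?u j k * of_real (half_step (yn g) k))"
    for F :: "nat \<Rightarrow> nat \<Rightarrow> complex"
  have u: "vanishes_on_Gamma g ?u" using W by (simp add: vanishes_on_Gamma_def)
  have split: "hamiltonian c g W j k * complex_of_real (cell_width g j)
      = - complex_of_real ((hbar c)\<^sup>2 / 2) * (T1 j k + T2 j k + T3 j k + T4 j k)
        + complex_of_real (?v j * cell_width g j) * W j k"
    if "j \<in> {1..nx g}" "k \<in> {1..ny g - 1}" for j k
    unfolding T1_def T2_def T3_def T4_def a_def b_def p_def q_def X_def Y_def
    by (rule hamiltonian_split[OF that])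
  have "inner_mesh g (hamiltonian c g W) W
      = (\<Sum>j = 1..nx g. \<Sum>k = 1..ny g - 1. (hamiltonian c g W j k * of_real (cell_width g j))
           * ?u j k * of_real (half_step (yn g) k))"
    unfolding inner_mesh_weights by (simp add: mult_ac)
  also have "\<dots> = \<Sigma> (\<lambda>j k. - complex_of_real ((hbar c)\<^sup>2 / 2) * (T1 j k + T2 j k + T3 j k + T4 j k)
        + complex_of_real (?v j * cell_width g j) * W j k)"
    unfolding \<Sigma>_def using split by (intro sum.cong refl) auto
  also have "\<dots> = - complex_of_real ((hbar c)\<^sup>2 / 2) * (\<Sigma> T1 + (\<Sigma> T2 + \<Sigma> T3) + \<Sigma> T4)
      + \<Sigma> (\<lambda>j k. complex_of_real (?v j * cell_width g j) * W j k)"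
    unfolding \<Sigma>_def by (simp only: distrib_right distrib_left sum.distrib sum_distrib_left mult.assoc add.assoc)
  finally have form: "inner_mesh g (hamiltonian c g W) W = \<dots>" .
  have "\<Sigma> T1 = (\<Sum>k = 1..ny g - 1. (\<Sum>j = 1..nx g. T1 j k * ?u j k) * of_real (half_step (yn g) k))"
    unfolding \<Sigma>_def by (subst sum.swap) (simp add: sum_distrib_right)
  also have "\<dots> = (\<Sum>k = 1..ny g - 1. - (\<Sum>j = 1..nx g. a j k * in_x (bar_d (xn g)) ?u j k
      * of_real (step (xn g) j)) * of_real (half_step (yn g) k))"
    unfolding T1_def using x_difference_by_parts[OF u] by (intro sum.cong refl) auto
  also have "Im \<dots> = 0"
    unfolding sum_distrib_right sum_negf[symmetric]
    by (intro Im_sum_sum_eq_0) (simp add: a_def in_x_def flip: cnj_bar_d)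
  finally have "Im (\<Sigma> T1) = 0" .
  moreover have "Im (\<Sigma> T2 + \<Sigma> T3) = 0"
  proof -
    have far: "p (nx g) k = 0" "q (nx g) k = 0" if "k \<in> {1..ny g}" for k
      using B12_h_far[OF that] B21_h_eq_B12_h[of "nx g" k] that nx_ge by (auto simp: p_def q_def)
    have "\<Sigma> T2 = - (\<Sum>j = 1..nx g. \<Sum>k = 1..ny g. p j k * cnj (Y j k)
            * of_real (step (xn g) j * step (yn g) k))"
      unfolding \<Sigma>_def T2_def
      by (subst xy_difference_by_parts[where a = p, OF u far(1)])
        (simp_all add: Y_def in_x_def in_y_def bar_s_bar_d_commute cnj_bar_d cnj_bar_s)
    moreover have "\<Sigma> T3 = - (\<Sum>j = 1..nx g. \<Sum>k = 1..ny g. q j k * cnj (X j k)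
            * of_real (step (xn g) j * step (yn g) k))"
      unfolding \<Sigma>_def T3_def
      by (subst yx_difference_by_parts[where a = q, OF u far(2)])
        (simp_all add: X_def in_x_def in_y_def bar_d_bar_s_commute cnj_bar_d cnj_bar_s)
    ultimately have "\<Sigma> T2 + \<Sigma> T3 = - (\<Sum>j = 1..nx g. \<Sum>k = 1..ny g.
        (p j k * cnj (Y j k) + q j k * cnj (X j k)) * of_real (step (xn g) j * step (yn g) k))"
      by (simp add: distrib_right sum.distrib)
    moreover have "Im (\<Sum>j = 1..nx g. \<Sum>k = 1..ny g.
        (p j k * cnj (Y j k) + q j k * cnj (X j k)) * of_real (step (xn g) j * step (yn g) k)) = 0"
      using B21_h_eq_B12_h
      by (intro Im_sum_sum_eq_0) (auto simp: p_def q_def algebra_simps)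
    ultimately show ?thesis by simp
  qed
  moreover have "Im (\<Sigma> T4) = 0"
  proof -
    have "\<Sigma> T4 = (\<Sum>j = 1..nx g. (\<Sum>k = 1..ny g - 1. in_y (hat_d (yn g)) b j k * ?u j k
        * of_real (half_step (yn g) k)) * of_real (cell_width g j))"
      unfolding \<Sigma>_def T4_def by (simp add: sum_distrib_left mult_ac)
    also have "\<dots> = (\<Sum>j = 1..nx g. - (\<Sum>k = 1..ny g. b j k * in_y (bar_d (yn g)) ?u j k
        * of_real (step (yn g) k)) * of_real (cell_width g j))"
      using u by (intro sum.cong refl arg_cong2[of _ _ _ _ "(*)"] y_difference_by_parts)
        (auto simp: vanishes_on_Gamma_def)
    also have "Im \<dots> = 0"
      unfolding sum_distrib_right sum_negf[symmetric]
      by (intro Im_sum_sum_eq_0) (simp add: b_def in_y_def flip: cnj_bar_d)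
    finally show ?thesis .
  qed
  moreover have "Im (\<Sigma> (\<lambda>j k. complex_of_real (?v j * cell_width g j) * W j k)) = 0"
    unfolding \<Sigma>_def by (intro Im_sum_sum_eq_0) simp
  ultimately show ?thesis
    unfolding form by (simp flip: of_real_power)
qed

section \<open>Energy balance of one time level\<close>

lemma inner_mesh_boundary_flux:
  "inner_mesh g (boundary_flux c g s) A
     = complex_of_real ((hbar c)\<^sup>2 * B1_inf c / 2) * inner_delta g s (A (nx g))"
proof -
  have "step (xn g) (nx g) > 0" using x_step_pos nx_ge by simp
  then have last: "boundary_flux c g s j k * cnj (A j k) * complex_of_real (cell_width g j * half_step (yn g) k)
      = (if j = nx g then complex_of_real ((hbar c)\<^sup>2 * B1_inf c / 2)
           * (s k * cnj (A (nx g) k) * complex_of_real (half_step (yn g) k)) else 0)" for j k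
    by (simp add: boundary_flux_def cell_width_def field_simps)
  show ?thesis
    unfolding inner_mesh_weights last inner_delta_def sum_distrib_left
    by (subst sum.swap) (use nx_ge in \<open>simp add: sum.delta\<close>)
qed

text \<open>
  The discrete conservation law. The Hamiltonian is tested with the very function it is applied to
  and contributes nothing; the half-cell weight \<open>h / 2\<close> cancels the division of the boundary
  condition, which leaves the inner product of the boundary operator with the average at \<open>x\<^sub>J\<close>.
\<close>

lemma energy_balance:
  assumes "\<tau> > 0" and "vanishes_on_Gamma g P" "vanishes_on_Gamma g Q"
    and eq: "\<And>j k. j \<in> {1..nx g} \<Longrightarrow> k \<in> {1..ny g - 1} \<Longrightarrow>
      \<i> * complex_of_real (hbar c * rho_h c g j k) * ((Q j k - P j k) / complex_of_real \<tau>)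
      = hamiltonian c g (\<lambda>j k. (Q j k + P j k) / 2) j k + G j k - boundary_flux c g s j k"
  shows "mass c g Q - mass c g P
    = 2 * \<tau> / hbar c * Im (inner_mesh g G (\<lambda>j k. (Q j k + P j k) / 2))
      - hbar c * B1_inf c * \<tau> * Im (inner_delta g s (\<lambda>k. (Q (nx g) k + P (nx g) k) / 2))"
proof -
  define A where "A = (\<lambda>j k. (Q j k + P j k) / 2)"
  let ?w = "\<lambda>j k. cell_width g j * half_step (yn g) k"
  have A: "vanishes_on_Gamma g A" using assms(2,3) by (simp add: vanishes_on_Gamma_def A_def)
  have "(\<Sum>j = 1..nx g. \<Sum>k = 1..ny g - 1.
        \<i> * complex_of_real (hbar c * rho_h c g j k) * ((Q j k - P j k) / complex_of_real \<tau>)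
          * cnj (A j k) * complex_of_real (?w j k))
      = (\<Sum>j = 1..nx g. \<Sum>k = 1..ny g - 1.
        (hamiltonian c g A j k + G j k - boundary_flux c g s j k)
          * cnj (A j k) * complex_of_real (?w j k))"
    using eq by (intro sum.cong refl) (simp add: A_def)
  moreover have "\<dots> = inner_mesh g (hamiltonian c g A) A + inner_mesh g G A
      - inner_mesh g (boundary_flux c g s) A"
    unfolding inner_mesh_weights
    by (simp only: left_diff_distrib distrib_right sum.distrib sum_subtractf)
  moreover have Im_scale: "Im (complex_of_real t * z) = t * Im z" for t z by simp
  ultimately have "Im (\<Sum>j = 1..nx g. \<Sum>k = 1..ny g - 1.
        \<i> * complex_of_real (hbar c * rho_h c g j k) * ((Q j k - P j k) / complex_of_real \<tau>)
          * cnj (A j k) * complex_of_real (?w j k))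
      = Im (inner_mesh g G A) - (hbar c)\<^sup>2 * B1_inf c / 2 * Im (inner_delta g s (A (nx g)))"
    using Im_hamiltonian_form[OF A] Im_scale
    by (simp only: inner_mesh_boundary_flux minus_complex.sel plus_complex.sel add_0)
  moreover have "Im (\<Sum>j = 1..nx g. \<Sum>k = 1..ny g - 1.
        \<i> * complex_of_real (hbar c * rho_h c g j k) * ((Q j k - P j k) / complex_of_real \<tau>)
          * cnj (A j k) * complex_of_real (?w j k))
      = hbar c / (2 * \<tau>) * (mass c g Q - mass c g P)"
    unfolding Im_sum mass_def sum_subtractf[symmetric] sum_distrib_left A_def
    using assms(1) by (intro sum.cong refl) (subst Im_crank_nicolson_term, auto simp: field_simps)
  ultimately have "hbar c / (2 * \<tau>) * (mass c g Q - mass c g P)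
      = Im (inner_mesh g G A) - (hbar c)\<^sup>2 * B1_inf c / 2 * Im (inner_delta g s (A (nx g)))"
    by simp
  then have "mass c g Q - mass c g P = 2 * \<tau> / hbar c *
      (Im (inner_mesh g G A) - (hbar c)\<^sup>2 * B1_inf c / 2 * Im (inner_delta g s (A (nx g))))"
    using assms(1) hbar_pos by (simp add: field_simps)
  then show ?thesis
    using hbar_pos by (simp add: A_def right_diff_distrib power2_eq_square)
qed

section \<open>Solvability of one time level\<close>

lemma E_factor_far:
  assumes "k \<in> {1..ny g - 1}"
  shows "E_factor f c g m (nx g) k = 1"
  using Delta_V_h_far[OF assms] by (cases f) (simp_all add: E_factor_def)

lemma eq_on_mesh_iff:
  assumes "vanishes_on_Gamma g U" "vanishes_on_Gamma g W"
  shows "eq_on_mesh g U W \<longleftrightarrow> (\<forall>j\<in>{1..nx g}. \<forall>k\<in>{1..ny g - 1}. U j k = W j k)"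
proof
  assume interior: "\<forall>j\<in>{1..nx g}. \<forall>k\<in>{1..ny g - 1}. U j k = W j k"
  have "U j k = W j k" if "j \<in> {0..nx g}" "k \<in> {0..ny g}" for j k
  proof (cases "k = 0 \<or> k = ny g")
    case True
    then show ?thesis using assms that by (auto simp: vanishes_on_Gamma_def)
  next
    case False
    then have "k \<in> {1..ny g - 1}" using that by auto
    then show ?thesis
      using assms interior that by (cases "j = 0") (auto simp: vanishes_on_Gamma_def)
  qed
  then show "eq_on_mesh g U W" by (simp add: eq_on_mesh_def)
qed (auto simp: eq_on_mesh_def)

lemma vanishes_on_Gamma_if_interior_support:
  assumes "\<And>j k. (j, k) \<notin> {1..nx g} \<times> {1..ny g - 1} \<Longrightarrow> W j k = 0"
  shows "vanishes_on_Gamma g W"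
proof -
  have "ny g \<notin> {1..ny g - 1}" using ny_pos by auto
  then show ?thesis
    unfolding vanishes_on_Gamma_def by (intro conjI ballI assms) auto
qed

text \<open>
  The assumption on \<open>S\<close> speaks of all time levels together. For a boundary function that is zero
  before level \<open>m\<close> all summands but the last vanish, so it bounds the flux of a single level,
  and the mass of \<open>Q\<close> is at most zero. The history \<open>Z\<close> is constrained only at the levels and nodes
  that \<open>S m\<close> depends on, and \<open>P\<close> only on the mesh, so that differences of two solutions of the
  scheme, arbitrary off the mesh, can be inserted as they are.
\<close>

lemma level_problem_injective:
  assumes lin: "linear_boundary_operator g m (S m)"
    and diss: "dissipative_boundary_operators g S" and m: "m \<ge> 1"
    and P: "vanishes_on_Gamma g P" "\<And>j k. j \<in> {1..nx g} \<Longrightarrow> k \<in> {1..ny g - 1} \<Longrightarrow> P j k = 0"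
    and Q: "vanishes_on_Gamma g Q"
    and history: "\<And>l k. l \<in> {1..<m} \<Longrightarrow> k \<in> {1..ny g - 1} \<Longrightarrow> Z l k = 0"
      "\<And>k. k \<in> {1..ny g - 1} \<Longrightarrow> Z m k = Q (nx g) k"
    and eq: "\<And>j k. j \<in> {1..nx g} \<Longrightarrow> k \<in> {1..ny g - 1} \<Longrightarrow>
      \<i> * complex_of_real (hbar c * rho_h c g j k) * ((Q j k - P j k) / complex_of_real (step (tn g) m))
      = hamiltonian c g (\<lambda>j k. (Q j k + P j k) / 2) j k - boundary_flux c g (S m Z) j k"
    and jk: "j \<in> {1..nx g}" "k \<in> {1..ny g - 1}"
  shows "Q j k = 0"
proof -
  define \<Phi> where "\<Phi> l i = (if l = m then Q (nx g) i else 0)" for l i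
  let ?\<tau> = "step (tn g) m"
  let ?flux = "inner_delta g (S m Z) (\<lambda>k. (Q (nx g) k + P (nx g) k) / 2)"
  have "S m Z k = S m \<Phi> k" if "k \<in> {1..ny g - 1}" for k
    using history by (intro linear_boundary_operator_local[OF lin that]) (auto simp: \<Phi>_def)
  then have flux: "?flux = inner_delta g (S m \<Phi>) (\<lambda>k. (\<Phi> (m - 1) k + \<Phi> m k) / 2)"
    unfolding inner_delta_def using m P(2) nx_ge by (intro sum.cong refl) (auto simp: \<Phi>_def)
  have "inner_delta g (S l \<Phi>) (\<lambda>k. (\<Phi> (l - 1) k + \<Phi> l k) / 2) = 0" if "l < m" for l
  proof -
    have "l \<noteq> m" "l - 1 \<noteq> m" using that by auto
    then show ?thesis by (simp add: inner_delta_def \<Phi>_def)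
  qed
  then have total: "(\<Sum>l = 1..m. inner_delta g (S l \<Phi>) (\<lambda>k. (\<Phi> (l - 1) k + \<Phi> l k) / 2)
      * complex_of_real (step (tn g) l)) = ?flux * complex_of_real ?\<tau>"
    using m by (subst sum_split_last) (auto simp: flux intro!: sum.neutral)
  have "(\<forall>k\<in>{0..ny g}. \<Phi> 0 k = 0) \<and> (\<forall>l. \<Phi> l 0 = 0 \<and> \<Phi> l (ny g) = 0)"
    using Q m by (auto simp: \<Phi>_def vanishes_on_Gamma_def)
  then have "Im (\<Sum>l = 1..m. inner_delta g (S l \<Phi>) (\<lambda>k. (\<Phi> (l - 1) k + \<Phi> l k) / 2)
      * complex_of_real (step (tn g) l)) \<ge> 0"
    using diss m unfolding dissipative_boundary_operators_def by blast
  then have "Im (?flux * complex_of_real ?\<tau>) \<ge> 0" unfolding total .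
  then have "Im ?flux \<ge> 0"
    using tau_pos[OF m] by (simp add: zero_le_mult_iff)
  moreover have "mass c g Q - mass c g P
      = - (hbar c * B1_inf c * ?\<tau> * Im ?flux)"
    using energy_balance[OF tau_pos[OF m] P(1) Q, of "\<lambda>_ _. 0" "S m Z"] eq
    by (simp add: inner_mesh_def)
  moreover have "mass c g P = 0"
    using P(2) by (simp add: mass_def)
  ultimately have "mass c g Q \<le> 0"
    using hbar_pos B1_pos tau_pos[OF m] by simp
  then show ?thesis using jk by (rule mass_eq_0_imp)
qed

text \<open>
  The unknowns are the values of \<open>Q\<close> at the nodes of \<open>I\<close>, and there is one equation for each of
  them. By linearity \<open>S m\<close> splits into its action on the new level, part of the operator \<open>L\<close>, and on
  the known history \<open>R\<close>, part of the right-hand side.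
\<close>

lemma level_problem_solvable:
  assumes lin: "linear_boundary_operator g m (S m)"
    and diss: "dissipative_boundary_operators g S" and m: "m \<ge> 1"
  obtains Q where "vanishes_on_Gamma g Q"
    and "\<And>j k. j \<in> {1..nx g} \<Longrightarrow> k \<in> {1..ny g - 1} \<Longrightarrow>
      \<i> * complex_of_real (hbar c * rho_h c g j k) * ((Q j k - P j k) / complex_of_real (step (tn g) m))
      = hamiltonian c g (\<lambda>j k. (Q j k + P j k) / 2) j k + G j k
        - boundary_flux c g (S m (\<lambda>l i. if l = m then Q (nx g) i else R l i)) j k"
proof -
  define I where "I = {1..nx g} \<times> {1..ny g - 1}"
  let ?\<tau> = "step (tn g) m"
  define D where "D j k = \<i> * complex_of_real (hbar c * rho_h c g j k) / complex_of_real ?\<tau>" for j k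
  define T where "T U = S m (\<lambda>l i. if l = m then U (nx g, i) else 0)" for U :: "nat \<times> nat \<Rightarrow> complex"
  define L where "L U = (\<lambda>(j, k). D j k * U (j, k)
      - hamiltonian c g (\<lambda>j k. U (j, k) / 2) j k + boundary_flux c g (T U) j k)" for U
  define b where "b = (\<lambda>(j, k). D j k * P j k
      + hamiltonian c g (\<lambda>j k. P j k / 2) j k + G j k
      - boundary_flux c g (S m (\<lambda>l i. if l = m then 0 else R l i)) j k)"
  have "\<exists>U. (\<forall>i. i \<notin> I \<longrightarrow> U i = 0) \<and> (\<forall>e\<in>I. L U e = b e)"
  proof (rule injective_imp_solvable)
    show "finite I" by (simp add: I_def)
  next
    fix x y :: complex and U W :: "nat \<times> nat \<Rightarrow> complex" and e
    assume "e \<in> I"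
    then obtain j k where e: "e = (j, k)" "j \<in> {1..nx g}" "k \<in> {1..ny g - 1}"
      by (auto simp: I_def)
    have "(\<lambda>j k. (x * U (j, k) + y * W (j, k)) / 2) = (\<lambda>j k. x * (U (j, k) / 2) + y * (W (j, k) / 2))"
      by (simp add: add_divide_distrib)
    then have H: "hamiltonian c g (\<lambda>j k. (x * U (j, k) + y * W (j, k)) / 2) j k
        = x * hamiltonian c g (\<lambda>j k. U (j, k) / 2) j k + y * hamiltonian c g (\<lambda>j k. W (j, k) / 2) j k"
      by (simp only: hamiltonian_linear)
    have "(\<lambda>l i. if l = m then x * U (nx g, i) + y * W (nx g, i) else 0)
        = (\<lambda>l i. x * (if l = m then U (nx g, i) else 0) + y * (if l = m then W (nx g, i) else 0))"
      by (intro ext) simp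
    then have "T (\<lambda>i. x * U i + y * W i) k = x * T U k + y * T W k"
      unfolding T_def by (simp only: linear_boundary_operatorD[OF lin e(3)])
    then have "boundary_flux c g (T (\<lambda>i. x * U i + y * W i)) j k
        = x * boundary_flux c g (T U) j k + y * boundary_flux c g (T W) j k"
      by (rule boundary_flux_combination)
    with H show "L (\<lambda>i. x * U i + y * W i) e = x * L U e + y * L W e"
      by (simp add: L_def e(1) algebra_simps)
  next
    fix U
    assume support: "\<forall>i. i \<notin> I \<longrightarrow> U i = 0" and kernel: "\<forall>e\<in>I. L U e = 0"
    have "U (j, k) = 0" if jk: "j \<in> {1..nx g}" "k \<in> {1..ny g - 1}" for j k
    proof (rule level_problem_injective[OF lin diss m, of "\<lambda>_ _. 0" "\<lambda>j k. U (j, k)"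
            "\<lambda>l i. if l = m then U (nx g, i) else 0", OF _ _ _ _ _ _ jk])
      show "vanishes_on_Gamma g (\<lambda>j k. U (j, k))"
        using support by (intro vanishes_on_Gamma_if_interior_support) (auto simp: I_def)
    next
      fix j k
      assume "j \<in> {1..nx g}" "k \<in> {1..ny g - 1}"
      then have "L U (j, k) = 0" using kernel by (simp add: I_def)
      then show "\<i> * complex_of_real (hbar c * rho_h c g j k) * ((U (j, k) - 0) / complex_of_real ?\<tau>)
          = hamiltonian c g (\<lambda>j k. (U (j, k) + 0) / 2) j k
            - boundary_flux c g (S m (\<lambda>l i. if l = m then U (nx g, i) else 0)) j k"
        by (simp add: L_def D_def T_def algebra_simps)
    qed (auto simp: vanishes_on_Gamma_def)
    then show "\<forall>i\<in>I. U i = 0" by (auto simp: I_def)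
  qed
  then obtain U where support: "\<And>i. i \<notin> I \<Longrightarrow> U i = 0" and U: "\<And>e. e \<in> I \<Longrightarrow> L U e = b e" by blast
  show thesis
  proof (rule that[of "\<lambda>j k. U (j, k)"])
    show "vanishes_on_Gamma g (\<lambda>j k. U (j, k))"
      using support by (intro vanishes_on_Gamma_if_interior_support) (auto simp: I_def)
  next
    fix j k
    assume jk: "j \<in> {1..nx g}" "k \<in> {1..ny g - 1}"
    let ?Z = "\<lambda>l i. if l = m then U (nx g, i) else R l i"
    have "(\<lambda>j k. (U (j, k) + P j k) / 2) = (\<lambda>j k. 1 * (U (j, k) / 2) + 1 * (P j k / 2))"
      by (simp add: add_divide_distrib)
    then have H: "hamiltonian c g (\<lambda>j k. (U (j, k) + P j k) / 2) j k
        = hamiltonian c g (\<lambda>j k. U (j, k) / 2) j k + hamiltonian c g (\<lambda>j k. P j k / 2) j k"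
      by (simp only: hamiltonian_linear) simp
    have "?Z = (\<lambda>l i. 1 * (if l = m then U (nx g, i) else 0) + 1 * (if l = m then 0 else R l i))"
      by (intro ext) simp
    then have "S m ?Z k = 1 * T U k + 1 * S m (\<lambda>l i. if l = m then 0 else R l i) k"
      unfolding T_def by (simp only: linear_boundary_operatorD[OF lin jk(2)])
    then have "boundary_flux c g (S m ?Z) j k = 1 * boundary_flux c g (T U) j k
        + 1 * boundary_flux c g (S m (\<lambda>l i. if l = m then 0 else R l i)) j k"
      by (rule boundary_flux_combination)
    then have flux: "boundary_flux c g (S m ?Z) j k = boundary_flux c g (T U) j k
        + boundary_flux c g (S m (\<lambda>l i. if l = m then 0 else R l i)) j k"
      by simp
    have "L U (j, k) = b (j, k)" using U jk by (simp add: I_def)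
    moreover have difference_quotient:
      "\<i> * complex_of_real (hbar c * rho_h c g j k) * ((U (j, k) - P j k) / complex_of_real ?\<tau>)
        = D j k * U (j, k) - D j k * P j k"
      by (simp add: D_def diff_divide_distrib right_diff_distrib)
    ultimately show "\<i> * complex_of_real (hbar c * rho_h c g j k) * ((U (j, k) - P j k) / complex_of_real ?\<tau>)
        = hamiltonian c g (\<lambda>j k. (U (j, k) + P j k) / 2) j k + G j k - boundary_flux c g (S m ?Z) j k"
      unfolding H flux difference_quotient by (simp add: L_def b_def algebra_simps)
  qed
qed

section \<open>Existence and uniqueness for the scheme\<close>

text \<open>
  One time level of the scheme, with the interior equation and the boundary condition merged into a
  single equation on all columns \<open>1, \<dots>, J\<close>.
\<close>

definition scheme_level ::
    "splitting_factor \<Rightarrow> (nat \<Rightarrow> (nat \<Rightarrow> nat \<Rightarrow> complex) \<Rightarrow> nat \<Rightarrow> complex) \<Rightarrow>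
     (nat \<Rightarrow> nat \<Rightarrow> nat \<Rightarrow> complex) \<Rightarrow> nat \<Rightarrow> (nat \<Rightarrow> nat \<Rightarrow> nat \<Rightarrow> complex) \<Rightarrow>
     (nat \<Rightarrow> nat \<Rightarrow> nat \<Rightarrow> complex) \<Rightarrow> (nat \<Rightarrow> nat \<Rightarrow> nat \<Rightarrow> complex) \<Rightarrow> bool" where
  "scheme_level f S F m P Q \<Psi> \<longleftrightarrow>
     vanishes_on_Gamma g (P m) \<and> vanishes_on_Gamma g (Q m) \<and> vanishes_on_Gamma g (\<Psi> m) \<and>
     (\<forall>j\<in>{1..nx g}. \<forall>k\<in>{1..ny g - 1}.
        P m j k = E_factor f c g m j k * \<Psi> (m - 1) j k \<and>
        \<Psi> m j k = E_factor f c g m j k * Q m j k \<and>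
        \<i> * complex_of_real (hbar c * rho_h c g j k) * ((Q m j k - P m j k) / complex_of_real (step (tn g) m))
        = hamiltonian c g (\<lambda>j k. (Q m j k + P m j k) / 2) j k + F m j k
          - boundary_flux c g (S m (\<lambda>l i. Q l (nx g) i)) j k)"

text \<open>
  The two sides differ by the factor \<open>- h / 2\<close> and by the values of \<open>\<rho>\<close> and \<open>B\<^sub>1\<^sub>1\<close> at \<open>x\<^sub>J\<close>, which
  are those at infinity.
\<close>

lemma transparent_condition_iff:
  assumes "k \<in> {1..ny g - 1}"
  shows "complex_of_real ((hbar c)\<^sup>2 / 2 * B1_inf c) * in_x (bar_d (xn g)) A (nx g) k
       - complex_of_real (step (xn g) (nx g) / 2) *
         (\<i> * complex_of_real (hbar c * rho_inf c) * d
          + (complex_of_real ((hbar c)\<^sup>2 / 2 * B2_inf c) * in_y (hat_d (yn g)) (in_y (bar_d (yn g)) A) (nx g) k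
             - complex_of_real (V_inf c) * A (nx g) k))
       + complex_of_real (step (xn g) (nx g) / 2) * \<phi>
       = complex_of_real ((hbar c)\<^sup>2 / 2 * B1_inf c) * s k
     \<longleftrightarrow> \<i> * complex_of_real (hbar c * rho_h c g (nx g) k) * d
       = hamiltonian c g A (nx g) k + \<phi> - boundary_flux c g s (nx g) k"
proof -
  have "step (xn g) (nx g) \<noteq> 0" using x_step_pos[of "nx g"] nx_ge by simp
  moreover have "C * b * X - of_real (h / 2) * (e + (C * b' * Y - v)) + of_real (h / 2) * p = C * b * z
      \<longleftrightarrow> e = (C * (of_real (2 / h) * (b * X) - b' * Y) + v) + p - C * of_real (2 / h) * b * z"
    if "h \<noteq> 0" for C b X e b' Y v p z :: complex and h :: real
  proof -
    have "C * b * X - of_real (h / 2) * (e + (C * b' * Y - v)) + of_real (h / 2) * p - C * b * z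
      = - of_real (h / 2) *
        (e - ((C * (of_real (2 / h) * (b * X) - b' * Y) + v) + p - C * of_real (2 / h) * b * z))"
      using that by (simp add: field_simps)
    then show ?thesis
      using that by (metis (no_types, lifting) divide_eq_0_iff eq_iff_diff_eq_0 mult_eq_0_iff
          neg_equal_0_iff_equal of_real_eq_0_iff zero_neq_numeral)
  qed
  moreover have "complex_of_real ((hbar c)\<^sup>2 * B1_inf c / step (xn g) (nx g))
      = complex_of_real ((hbar c)\<^sup>2 / 2) * of_real (2 / step (xn g) (nx g)) * of_real (B1_inf c)"
    by simp
  ultimately show ?thesis
    unfolding hamiltonian_def half_cell_hamiltonian_def boundary_flux_def if_P[OF refl]
      B11_h_far[OF assms] rho_h_far[OF assms] scaleR_conv_of_real of_real_mult
    by presburger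
qed

lemma level_equations_iff:
  "(\<forall>j\<in>{1..nx g}. \<forall>k\<in>{1..ny g - 1}. \<i> * complex_of_real (hbar c * rho_h c g j k) * d j k
        = hamiltonian c g A j k + \<phi> j k - boundary_flux c g s j k)
   \<longleftrightarrow> (\<forall>j\<in>{1..nx g - 1}. \<forall>k\<in>{1..ny g - 1}. \<i> * complex_of_real (hbar c * rho_h c g j k) * d j k
        = H0_h c g A j k + complex_of_real (V_aux_h c g j) * A j k + \<phi> j k) \<and>
     (\<forall>k\<in>{1..ny g - 1}. complex_of_real ((hbar c)\<^sup>2 / 2 * B1_inf c) * in_x (bar_d (xn g)) A (nx g) k
       - complex_of_real (step (xn g) (nx g) / 2) *
         (\<i> * complex_of_real (hbar c * rho_inf c) * d (nx g) k
          + (complex_of_real ((hbar c)\<^sup>2 / 2 * B2_inf c) * in_y (hat_d (yn g)) (in_y (bar_d (yn g)) A) (nx g) k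
             - complex_of_real (V_inf c) * A (nx g) k))
       + complex_of_real (step (xn g) (nx g) / 2) * \<phi> (nx g) k
       = complex_of_real ((hbar c)\<^sup>2 / 2 * B1_inf c) * s k)"
  (is "(\<forall>j\<in>_. \<forall>k\<in>_. ?R j k) \<longleftrightarrow> (\<forall>j\<in>_. \<forall>k\<in>_. ?I j k) \<and> (\<forall>k\<in>_. ?T k)")
proof -
  have "{1..nx g} = insert (nx g) {1..nx g - 1}" using nx_ge by auto
  moreover have "?R j k \<longleftrightarrow> ?I j k" if "j \<in> {1..nx g - 1}" for j k
  proof -
    have "j \<noteq> nx g" using that nx_ge by auto
    then show ?thesis by (simp add: hamiltonian_def boundary_flux_def)
  qed
  moreover have "?R (nx g) k \<longleftrightarrow> ?T k" if "k \<in> {1..ny g - 1}" for k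
    using transparent_condition_iff[OF that] by simp
  ultimately show ?thesis by (simp only: ball_simps conj_commute cong: ball_cong)
qed

lemma scheme_solution_iff_levels:
  "scheme_solution f c g S F P Q \<Psi> \<longleftrightarrow>
     eq_on_mesh g (\<Psi> 0) (Psi_init_h c g) \<and> (\<forall>m\<ge>1. scheme_level f S F m P Q \<Psi>)"
  unfolding scheme_solution_def Let_def scheme_level_def ball_conj_distrib level_equations_iff
  by (simp only: conj_ac)

lemma scheme_level_cong:
  assumes "linear_boundary_operator g m (S m)"
    and "\<And>l. l \<le> m \<Longrightarrow> P' l = P l" "\<And>l. l \<le> m \<Longrightarrow> Q' l = Q l" "\<And>l. l \<le> m \<Longrightarrow> \<Psi>' l = \<Psi> l"
    and "scheme_level f S F m P Q \<Psi>"
  shows "scheme_level f S F m P' Q' \<Psi>'"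
proof -
  have "S m (\<lambda>l i. Q' l (nx g) i) k = S m (\<lambda>l i. Q l (nx g) i) k" if "k \<in> {1..ny g - 1}" for k
    using assms(3) by (intro linear_boundary_operator_local[OF assms(1) that]) simp
  then have flux: "boundary_flux c g (S m (\<lambda>l i. Q' l (nx g) i)) j k
      = boundary_flux c g (S m (\<lambda>l i. Q l (nx g) i)) j k" if "k \<in> {1..ny g - 1}" for j k
    using that by (simp add: boundary_flux_def)
  have same: "P' m = P m" "Q' m = Q m" "\<Psi>' m = \<Psi> m" "\<Psi>' (m - 1) = \<Psi> (m - 1)"
    using assms(2-4) by auto
  have "scheme_level f S F m P' Q' \<Psi>' \<longleftrightarrow> scheme_level f S F m P Q \<Psi>"
    unfolding scheme_level_def same by (simp only: flux cong: ball_cong)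
  then show ?thesis using assms(5) by simp
qed

lemma scheme_level_extend:
  assumes lin: "\<And>m. m \<ge> 1 \<Longrightarrow> linear_boundary_operator g m (S m)"
    and diss: "dissipative_boundary_operators g S"
    and levels: "\<And>m. m \<in> {1..n} \<Longrightarrow> scheme_level f S F m P Q \<Psi>"
  shows "\<exists>P' Q' \<Psi>'. (\<forall>l\<le>n. P' l = P l \<and> Q' l = Q l \<and> \<Psi>' l = \<Psi> l) \<and>
    (\<forall>m\<in>{1..Suc n}. scheme_level f S F m P' Q' \<Psi>')"
proof -
  let ?m = "Suc n"
  let ?E = "E_factor f c g ?m"
  define cut where "cut W j k = (if j \<in> {1..nx g} \<and> k \<in> {1..ny g - 1} then W j k else 0)"
    for W :: "nat \<Rightarrow> nat \<Rightarrow> complex" and j k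
  have cut_vanishes: "vanishes_on_Gamma g (cut W)" for W
    by (rule vanishes_on_Gamma_if_interior_support) (auto simp: cut_def)
  define Pn where "Pn = cut (\<lambda>j k. ?E j k * \<Psi> n j k)"
  obtain Qn where Qn: "vanishes_on_Gamma g Qn"
    and eq: "\<And>j k. j \<in> {1..nx g} \<Longrightarrow> k \<in> {1..ny g - 1} \<Longrightarrow>
      \<i> * complex_of_real (hbar c * rho_h c g j k) * ((Qn j k - Pn j k) / complex_of_real (step (tn g) ?m))
      = hamiltonian c g (\<lambda>j k. (Qn j k + Pn j k) / 2) j k + F ?m j k
        - boundary_flux c g (S ?m (\<lambda>l i. if l = ?m then Qn (nx g) i else Q l (nx g) i)) j k"
    using level_problem_solvable[where P = Pn and G = "F ?m" and R = "\<lambda>l i. Q l (nx g) i",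
        OF lin[of ?m] diss] by auto
  define P' where "P' = P(?m := Pn)"
  define Q' where "Q' = Q(?m := Qn)"
  define \<Psi>n where "\<Psi>n = cut (\<lambda>j k. ?E j k * Qn j k)"
  define \<Psi>' where "\<Psi>' = \<Psi>(?m := \<Psi>n)"
  have agree: "P' l = P l" "Q' l = Q l" "\<Psi>' l = \<Psi> l" if "l \<le> n" for l
    using that by (auto simp: P'_def Q'_def \<Psi>'_def)
  have new: "P' ?m = Pn" "Q' ?m = Qn" "\<Psi>' ?m = \<Psi>n" "\<Psi>' (?m - 1) = \<Psi> n"
    by (auto simp: P'_def Q'_def \<Psi>'_def)
  have history: "(\<lambda>l i. Q' l (nx g) i) = (\<lambda>l i. if l = ?m then Qn (nx g) i else Q l (nx g) i)"
    by (intro ext) (simp add: Q'_def)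
  have "vanishes_on_Gamma g Pn" "vanishes_on_Gamma g \<Psi>n"
    by (simp_all add: Pn_def \<Psi>n_def cut_vanishes)
  moreover have "Pn j k = ?E j k * \<Psi> n j k" "\<Psi>n j k = ?E j k * Qn j k"
    if "j \<in> {1..nx g}" "k \<in> {1..ny g - 1}" for j k
    using that by (simp_all add: Pn_def \<Psi>n_def cut_def)
  ultimately have "scheme_level f S F ?m P' Q' \<Psi>'"
    unfolding scheme_level_def new history using Qn eq by blast
  moreover have "scheme_level f S F m P' Q' \<Psi>'" if "m \<in> {1..n}" for m
    using that agree levels lin by (intro scheme_level_cong[of m S P' P Q' Q \<Psi>' \<Psi>]) auto
  ultimately have "\<forall>m\<in>{1..Suc n}. scheme_level f S F m P' Q' \<Psi>'"
    by (auto simp: le_Suc_eq)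
  then show ?thesis using agree by blast
qed

text \<open>
  Each level depends on the whole history of boundary values. The sequence chosen therefore consists
  of complete triples of which the \<open>n\<close>-th solves the first \<open>n\<close> levels, each agreeing with the one
  before it on the levels already solved; the solution is read off on the diagonal.
\<close>

lemma scheme_solution_exists:
  assumes lin: "\<And>m. m \<ge> 1 \<Longrightarrow> linear_boundary_operator g m (S m)"
    and diss: "dissipative_boundary_operators g S"
  shows "\<exists>P Q \<Psi>. scheme_solution f c g S F P Q \<Psi>"
proof -
  let ?good = "\<lambda>n (P, Q, \<Psi>). \<Psi> 0 = Psi_init_h c g \<and> (\<forall>m\<in>{1..n}. scheme_level f S F m P Q \<Psi>)"
  let ?agree = "\<lambda>n (P, Q, \<Psi>) (P', Q', \<Psi>'). \<forall>l\<le>n. P' l = P l \<and> Q' l = Q l \<and> \<Psi>' l = \<Psi> l"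
  have base: "\<exists>s. ?good 0 s"
    by (rule exI[of _ "(\<lambda>_ _ _. 0, \<lambda>_ _ _. 0, \<lambda>_. Psi_init_h c g)"]) simp
  have extend: "\<exists>s'. ?good (Suc n) s' \<and> ?agree n s s'" if "?good n s" for n s
  proof -
    obtain P Q \<Psi> where s: "s = (P, Q, \<Psi>)" by (cases s)
    then have levels: "scheme_level f S F m P Q \<Psi>" if "m \<in> {1..n}" for m
      using \<open>?good n s\<close> that by auto
    obtain P' Q' \<Psi>' where "\<forall>l\<le>n. P' l = P l \<and> Q' l = Q l \<and> \<Psi>' l = \<Psi> l"
      and "\<forall>m\<in>{1..Suc n}. scheme_level f S F m P' Q' \<Psi>'"
      using scheme_level_extend[OF lin diss levels] by blast
    then show ?thesis
      using that s by (intro exI[of _ "(P', Q', \<Psi>')"]) auto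
  qed
  have "\<exists>seq. \<forall>n. ?good n (seq n) \<and> ?agree n (seq n) (seq (Suc n))"
    by (rule dependent_nat_choice[OF base extend])
  then obtain seq where seq: "\<forall>n. ?good n (seq n) \<and> ?agree n (seq n) (seq (Suc n))" ..
  have good: "?good n (seq n)" for n by (rule conjunct1[OF spec[OF seq]])
  have agree_Suc: "?agree n (seq n) (seq (Suc n))" for n by (rule conjunct2[OF spec[OF seq]])
  define P where "P m = fst (seq m) m" for m
  define Q where "Q m = fst (snd (seq m)) m" for m
  define \<Psi> where "\<Psi> m = snd (snd (seq m)) m" for m
  have stable: "fst (seq (l + d)) l = P l \<and> fst (snd (seq (l + d))) l = Q l \<and> snd (snd (seq (l + d))) l = \<Psi> l"
    for l d
  proof (induction d)
    case 0
    then show ?case by (simp add: P_def Q_def \<Psi>_def)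
  next
    case (Suc d)
    then show ?case using agree_Suc[of "l + d"] by (auto simp: case_prod_unfold)
  qed
  have "scheme_level f S F m P Q \<Psi>" if "m \<ge> 1" for m
  proof (rule scheme_level_cong[where S = S and m = m and P = "fst (seq m)"
        and Q = "fst (snd (seq m))" and \<Psi> = "snd (snd (seq m))"])
    show "linear_boundary_operator g m (S m)" by (rule lin[OF that])
  next
    show "scheme_level f S F m (fst (seq m)) (fst (snd (seq m))) (snd (snd (seq m)))"
      using good[of m] that by (auto simp: case_prod_unfold)
  next
    fix l assume "l \<le> m"
    then show "P l = fst (seq m) l" "Q l = fst (snd (seq m)) l" "\<Psi> l = snd (snd (seq m)) l"
      using stable[of l "m - l"] by auto
  qed
  moreover have "\<Psi> 0 = Psi_init_h c g"
    using good[of 0] by (simp add: \<Psi>_def case_prod_unfold)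
  ultimately show ?thesis
    unfolding scheme_solution_iff_levels by (intro exI[of _ P] exI[of _ Q] exI[of _ \<Psi>]) (simp add: eq_on_mesh_def)
qed

text \<open>
  The difference of two solutions solves the homogeneous level problem: its breve part and its
  history vanish by the agreement on earlier levels, and \<open>F\<close> cancels.
\<close>

lemma scheme_level_unique:
  assumes lin: "linear_boundary_operator g m (S m)"
    and diss: "dissipative_boundary_operators g S" and m: "m \<ge> 1"
    and level: "scheme_level f S F m P Q \<Psi>" "scheme_level f S F m P' Q' \<Psi>'"
    and previous: "eq_on_mesh g (\<Psi> (m - 1)) (\<Psi>' (m - 1))"
      "\<And>l. l \<in> {1..<m} \<Longrightarrow> eq_on_mesh g (Q l) (Q' l)"
  shows "eq_on_mesh g (P m) (P' m) \<and> eq_on_mesh g (Q m) (Q' m) \<and> eq_on_mesh g (\<Psi> m) (\<Psi>' m)"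
proof -
  have P_eq: "P m j k = P' m j k" if "j \<in> {1..nx g}" "k \<in> {1..ny g - 1}" for j k
    using level previous(1) that by (auto simp: scheme_level_def eq_on_mesh_def)
  have "Q m j k - Q' m j k = 0" if jk: "j \<in> {1..nx g}" "k \<in> {1..ny g - 1}" for j k
  proof (rule level_problem_injective[OF lin diss m, of "\<lambda>j k. P m j k - P' m j k"
        "\<lambda>j k. Q m j k - Q' m j k" "\<lambda>l i. Q l (nx g) i - Q' l (nx g) i", OF _ _ _ _ _ _ jk])
    fix l k
    assume "l \<in> {1..<m}" "k \<in> {1..ny g - 1}"
    then show "Q l (nx g) k - Q' l (nx g) k = 0"
      using eq_on_meshD[OF previous(2)] by simp
  next
    fix j k
    assume jk: "j \<in> {1..nx g}" "k \<in> {1..ny g - 1}"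
    let ?H = "hamiltonian c g" and ?r = "\<i> * complex_of_real (hbar c * rho_h c g j k)"
    let ?\<tau> = "complex_of_real (step (tn g) m)"
    have "(\<lambda>j k. (Q m j k - Q' m j k + (P m j k - P' m j k)) / 2)
        = (\<lambda>j k. 1 * ((Q m j k + P m j k) / 2) + (- 1) * ((Q' m j k + P' m j k) / 2))"
      by (intro ext) (simp add: add_divide_distrib diff_divide_distrib)
    then have H: "?H (\<lambda>j k. (Q m j k - Q' m j k + (P m j k - P' m j k)) / 2) j k
        = ?H (\<lambda>j k. (Q m j k + P m j k) / 2) j k - ?H (\<lambda>j k. (Q' m j k + P' m j k) / 2) j k"
      by (simp only: hamiltonian_linear) simp
    have "S m (\<lambda>l i. 1 * Q l (nx g) i + (- 1) * Q' l (nx g) i) k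
        = 1 * S m (\<lambda>l i. Q l (nx g) i) k + (- 1) * S m (\<lambda>l i. Q' l (nx g) i) k"
      by (rule linear_boundary_operatorD[OF lin jk(2)])
    then have "boundary_flux c g (S m (\<lambda>l i. 1 * Q l (nx g) i + (- 1) * Q' l (nx g) i)) j k
        = 1 * boundary_flux c g (S m (\<lambda>l i. Q l (nx g) i)) j k
          + (- 1) * boundary_flux c g (S m (\<lambda>l i. Q' l (nx g) i)) j k"
      by (rule boundary_flux_combination)
    then have flux: "boundary_flux c g (S m (\<lambda>l i. Q l (nx g) i - Q' l (nx g) i)) j k
        = boundary_flux c g (S m (\<lambda>l i. Q l (nx g) i)) j k - boundary_flux c g (S m (\<lambda>l i. Q' l (nx g) i)) j k"
      by simp
    have "?r * ((Q m j k - Q' m j k - (P m j k - P' m j k)) / ?\<tau>)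
        = ?r * ((Q m j k - P m j k) / ?\<tau>) - ?r * ((Q' m j k - P' m j k) / ?\<tau>)"
    proof -
      have "(Q m j k - Q' m j k - (P m j k - P' m j k)) / ?\<tau>
          = (Q m j k - P m j k) / ?\<tau> - (Q' m j k - P' m j k) / ?\<tau>"
        by (simp add: diff_divide_distrib)
      then show ?thesis by (simp only: right_diff_distrib)
    qed
    also have "\<dots> = (?H (\<lambda>j k. (Q m j k + P m j k) / 2) j k + F m j k
          - boundary_flux c g (S m (\<lambda>l i. Q l (nx g) i)) j k)
        - (?H (\<lambda>j k. (Q' m j k + P' m j k) / 2) j k + F m j k
          - boundary_flux c g (S m (\<lambda>l i. Q' l (nx g) i)) j k)"
    proof -
      have "?r * ((Q m j k - P m j k) / ?\<tau>) = ?H (\<lambda>j k. (Q m j k + P m j k) / 2) j k + F m j k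
          - boundary_flux c g (S m (\<lambda>l i. Q l (nx g) i)) j k"
        using level(1) jk unfolding scheme_level_def by blast
      moreover have "?r * ((Q' m j k - P' m j k) / ?\<tau>)
          = ?H (\<lambda>j k. (Q' m j k + P' m j k) / 2) j k + F m j k
            - boundary_flux c g (S m (\<lambda>l i. Q' l (nx g) i)) j k"
        using level(2) jk unfolding scheme_level_def by blast
      ultimately show ?thesis by (simp only:)
    qed
    finally show "?r * ((Q m j k - Q' m j k - (P m j k - P' m j k)) / ?\<tau>)
        = ?H (\<lambda>j k. (Q m j k - Q' m j k + (P m j k - P' m j k)) / 2) j k
          - boundary_flux c g (S m (\<lambda>l i. Q l (nx g) i - Q' l (nx g) i)) j k"
      unfolding H flux by simp
  qed (use level P_eq in \<open>auto simp: scheme_level_def vanishes_on_Gamma_def\<close>)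
  then have Q_eq: "Q m j k = Q' m j k" if "j \<in> {1..nx g}" "k \<in> {1..ny g - 1}" for j k
    using that by simp
  have "\<Psi> m j k = \<Psi>' m j k" if "j \<in> {1..nx g}" "k \<in> {1..ny g - 1}" for j k
    using level Q_eq that by (auto simp: scheme_level_def)
  then show ?thesis
    using level P_eq Q_eq by (auto simp: scheme_level_def eq_on_mesh_iff)
qed

lemma scheme_solution_unique:
  assumes lin: "\<And>m. m \<ge> 1 \<Longrightarrow> linear_boundary_operator g m (S m)"
    and diss: "dissipative_boundary_operators g S"
    and sol: "scheme_solution f c g S F P Q \<Psi>" "scheme_solution f c g S F P' Q' \<Psi>'"
  shows "(m \<ge> 1 \<longrightarrow> eq_on_mesh g (P m) (P' m) \<and> eq_on_mesh g (Q m) (Q' m)) \<and> eq_on_mesh g (\<Psi> m) (\<Psi>' m)"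
proof (induction m rule: less_induct)
  case (less m)
  show ?case
  proof (cases "m = 0")
    case True
    then show ?thesis using sol by (auto simp: scheme_solution_iff_levels eq_on_mesh_def)
  next
    case False
    then have "m \<ge> 1" by simp
    moreover have "eq_on_mesh g (\<Psi> (m - 1)) (\<Psi>' (m - 1))"
      using less.IH[of "m - 1"] False by simp
    moreover have "eq_on_mesh g (Q l) (Q' l)" if "l \<in> {1..<m}" for l
      using less.IH[of l] that by simp
    ultimately show ?thesis
      using sol scheme_level_unique[OF lin diss, of m f F P Q \<Psi> P' Q' \<Psi>']
      by (simp add: scheme_solution_iff_levels)
  qed
qed

section \<open>Decay of the mass\<close>

text \<open>
  At \<open>x\<^sub>J\<close> the potential steps are the identity, so the averages of breve and tilde functions there
  are the time averages of one boundary function \<open>\<Phi>\<close>. It starts from zero because the initial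
  function vanishes at \<open>x\<^sub>J\<close>. Hence the telescoping sum of the energy balances is governed by the
  sum in the assumption on \<open>S\<close>.
\<close>

lemma mass_decay:
  assumes lin: "\<And>m. m \<ge> 1 \<Longrightarrow> linear_boundary_operator g m (S m)"
    and diss: "dissipative_boundary_operators g S"
    and init: "\<And>k. k \<in> {1..ny g - 1} \<Longrightarrow> Psi_init_h c g (nx g) k = 0"
    and F: "\<And>m. m \<ge> 1 \<Longrightarrow> eq_on_mesh g (F m) (\<lambda>j k. 0)"
    and sol: "scheme_solution f c g S F P Q \<Psi>"
  shows "mass c g (\<Psi> M) \<le> mass c g (\<Psi> 0)"
proof -
  \<comment> \<open>The scheme leaves the tilde function undefined at level \<open>0\<close>; there \<open>\<Phi>\<close> takes the initial value.\<close>
  define \<Phi> where "\<Phi> l i = (if l = 0 then 0 else Q l (nx g) i)" for l i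
  let ?flux = "\<lambda>m. inner_delta g (S m \<Phi>) (\<lambda>k. (\<Phi> (m - 1) k + \<Phi> m k) / 2) * complex_of_real (step (tn g) m)"
  have level: "scheme_level f S F m P Q \<Psi>" if "m \<ge> 1" for m
    using sol that by (simp add: scheme_solution_iff_levels)
  have \<Psi>_edge: "\<Psi> m (nx g) k = \<Phi> m k" if "k \<in> {1..ny g - 1}" for m k
  proof (cases "m = 0")
    case True
    have "eq_on_mesh g (\<Psi> 0) (Psi_init_h c g)"
      using sol by (simp add: scheme_solution_iff_levels)
    then show ?thesis
      using True eq_on_meshD[of g "\<Psi> 0" "Psi_init_h c g" "nx g" k] init[OF that] that
      by (simp add: \<Phi>_def)
  next
    case False
    then show ?thesis
      using level[of m] that nx_ge by (simp add: scheme_level_def E_factor_far \<Phi>_def)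
  qed
  have balance: "mass c g (\<Psi> m) - mass c g (\<Psi> (m - 1)) = - (hbar c * B1_inf c * Im (?flux m))"
    if m: "m \<ge> 1" for m
  proof -
    have "S m (\<lambda>l i. Q l (nx g) i) k = S m \<Phi> k" if "k \<in> {1..ny g - 1}" for k
      by (rule linear_boundary_operator_local[OF lin[OF m] that]) (simp add: \<Phi>_def)
    moreover have "P m (nx g) k = \<Phi> (m - 1) k" if "k \<in> {1..ny g - 1}" for k
      using level[OF m] that nx_ge \<Psi>_edge[OF that, of "m - 1"] by (simp add: scheme_level_def E_factor_far)
    ultimately have flux: "inner_delta g (S m (\<lambda>l i. Q l (nx g) i)) (\<lambda>k. (Q m (nx g) k + P m (nx g) k) / 2)
        = inner_delta g (S m \<Phi>) (\<lambda>k. (\<Phi> (m - 1) k + \<Phi> m k) / 2)"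
      unfolding inner_delta_def using m by (intro sum.cong refl) (auto simp: \<Phi>_def add.commute)
    have "inner_mesh g (F m) A = 0" for A
      unfolding inner_mesh_weights using eq_on_meshD[OF F[OF m]] by (intro sum.neutral ballI) simp
    moreover have "mass c g (Q m) - mass c g (P m)
        = 2 * step (tn g) m / hbar c * Im (inner_mesh g (F m) (\<lambda>j k. (Q m j k + P m j k) / 2))
          - hbar c * B1_inf c * step (tn g) m * Im (inner_delta g (S m (\<lambda>l i. Q l (nx g) i))
              (\<lambda>k. (Q m (nx g) k + P m (nx g) k) / 2))"
      using level[OF m] unfolding scheme_level_def by (intro energy_balance tau_pos m) blast+
    ultimately have "mass c g (Q m) - mass c g (P m) = - (hbar c * B1_inf c * Im (?flux m))"
      by (simp add: flux)
    moreover have "mass c g (Q m) = mass c g (\<Psi> m)" "mass c g (P m) = mass c g (\<Psi> (m - 1))"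
      using level[OF m] by (auto intro!: mass_cong simp: scheme_level_def norm_mult cmod_E_factor)
    ultimately show ?thesis by simp
  qed
  have total: "mass c g (\<Psi> M) = mass c g (\<Psi> 0) - hbar c * B1_inf c * Im (\<Sum>m = 1..M. ?flux m)"
  proof (induction M)
    case (Suc M)
    then show ?case using balance[of "Suc M"] by (simp add: algebra_simps)
  qed simp
  have "(\<forall>k\<in>{0..ny g}. \<Phi> 0 k = 0) \<and> (\<forall>m. \<Phi> m 0 = 0 \<and> \<Phi> m (ny g) = 0)"
    using level by (auto simp: \<Phi>_def scheme_level_def vanishes_on_Gamma_def)
  then have "Im (\<Sum>m = 1..M. ?flux m) \<ge> 0" if "M \<ge> 1"
    using diss that unfolding dissipative_boundary_operators_def by blast
  then have "Im (\<Sum>m = 1..M. ?flux m) \<ge> 0" by (cases "M = 0") auto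
  then show ?thesis
    unfolding total using hbar_pos B1_pos by simp
qed

end

theorem corollary1:
  fixes f :: splitting_factor and c :: coefficients and g :: mesh
    and S :: "nat \<Rightarrow> (nat \<Rightarrow> nat \<Rightarrow> complex) \<Rightarrow> nat \<Rightarrow> complex"
    and F :: "nat \<Rightarrow> nat \<Rightarrow> nat \<Rightarrow> complex"
  assumes "admissible_coefficients c" and "admissible_mesh c g"
    and "\<forall>m\<ge>1. linear_boundary_operator g m (S m)"
    and "dissipative_boundary_operators g S"
    and "\<forall>m\<ge>1. vanishes_on_Gamma g (F m)"
    and "vanishes_on_Gamma g (Psi_init_h c g)"
    and "\<forall>k\<in>{0..ny g}. Psi_init_h c g (nx g) k = 0 \<and> Psi_init_h c g (nx g - 1) k = 0"
  shows "(\<exists>P Q \<Psi>. scheme_solution f c g S F P Q \<Psi>) \<and>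
    (\<forall>P Q \<Psi> P' Q' \<Psi>'.
       scheme_solution f c g S F P Q \<Psi> \<and> scheme_solution f c g S F P' Q' \<Psi>' \<longrightarrow>
       (\<forall>m\<ge>1. eq_on_mesh g (P m) (P' m) \<and> eq_on_mesh g (Q m) (Q' m)) \<and>
       (\<forall>m. eq_on_mesh g (\<Psi> m) (\<Psi>' m))) \<and>
    (\<forall>P Q \<Psi>. (\<forall>m\<ge>1. eq_on_mesh g (F m) (\<lambda>j k. 0)) \<and> scheme_solution f c g S F P Q \<Psi> \<longrightarrow>
       maximum_of
         (\<lambda>m. norm_mesh g (\<lambda>j k. complex_of_real (sqrt (rho_h c g j k)) * \<Psi> m j k))
         (norm_mesh g (\<lambda>j k. complex_of_real (sqrt (rho_h c g j k)) * Psi_init_h c g j k)))"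
proof -
  interpret admissible_scheme c g
    using assms(1,2) by unfold_locales
  have lin: "\<And>m. m \<ge> 1 \<Longrightarrow> linear_boundary_operator g m (S m)" using assms(3) by blast
  have "maximum_of
      (\<lambda>m. norm_mesh g (\<lambda>j k. complex_of_real (sqrt (rho_h c g j k)) * \<Psi> m j k))
      (norm_mesh g (\<lambda>j k. complex_of_real (sqrt (rho_h c g j k)) * Psi_init_h c g j k))"
    if F: "\<forall>m\<ge>1. eq_on_mesh g (F m) (\<lambda>j k. 0)" and sol: "scheme_solution f c g S F P Q \<Psi>" for P Q \<Psi>
  proof -
    have "mass c g (\<Psi> 0) = mass c g (Psi_init_h c g)"
      using sol eq_on_meshD[of g "\<Psi> 0" "Psi_init_h c g"]
      by (intro mass_cong) (simp add: scheme_solution_iff_levels)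
    moreover have "mass c g (\<Psi> m) \<le> mass c g (\<Psi> 0)" for m
      using assms(7) F by (intro mass_decay[OF lin assms(4) _ _ sol]) auto
    ultimately show ?thesis
      unfolding maximum_of_def norm_mesh_mass by (metis real_sqrt_le_iff)
  qed
  then show ?thesis
    using scheme_solution_exists[OF lin assms(4)] scheme_solution_unique[OF lin assms(4)] by blast
qed

end
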